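(* Consider the flat system $$(\mathcal{S}):\quad u^1_{x_ix_j}=0,\ i,j=1,\dots,n,\qquad u^k_x=A^ku^1_x,\ k=2,\dots,m,$$ with $n$ independent variables $x=(x_1,\dots,x_n)$ and $m$ dependent variables $u=(u^1,\dots,u^m)$, where $A^2,\dots,A^m$ are constant complex $n\times n$ matrices. Suppose that the matrices $A^1:=Id_n,A^2,\dots,A^m$ are linearly independent. Then $Lie(\mathcal{S})$ is finite dimensional.
   Context: $u^k_x=(u^k_{x_1},\dots,u^k_{x_n})$ is the (column) vector of first partial derivatives. All considerations are local. An infinitesimal symmetry of $(\mathcal{S})$ is a holomorphic vector field on a domain in $\mathbb{C}^n_x\times\mathbb{C}^m_u$ whose local flow maps graphs of (holomorphic) solutions of $(\mathcal{S})$ to graphs of solutions; $Lie(\mathcal{S})$ is the complex Lie algebra of infinitesimal symmetries. *)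

theory Defs
  imports "HOL-Analysis.Analysis" "HOL-Library.Function_Algebras"
begin

text \<open>
  The space of independent and dependent variables is \<open>complex^'n \<times> complex^'m\<close>. The library only
  provides its real scalar multiplication, so the complex vector space structures that occur below
  (on this product, on vector fields, on matrices) are introduced here.
\<close>

type_synonym ('n, 'm) pt = "(complex ^ 'n) \<times> (complex ^ 'm)"
type_synonym ('n, 'm) vfield = "('n, 'm) pt \<Rightarrow> ('n, 'm) pt"

definition pt_scale :: "complex \<Rightarrow> ('n::finite, 'm::finite) pt \<Rightarrow> ('n, 'm) pt"
  where "pt_scale c p = (c *s fst p, c *s snd p)"

definition vf_scale :: "complex \<Rightarrow> ('n::finite, 'm::finite) vfield \<Rightarrow> ('n, 'm) vfield"
  where "vf_scale c X = (\<lambda>p. pt_scale c (X p))"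

definition mat_scale :: "complex \<Rightarrow> complex ^ 'n::finite ^ 'n \<Rightarrow> complex ^ 'n ^ 'n"
  where "mat_scale c M = (\<chi> i. c *s (M $ i))"

global_interpretation pt: vector_space pt_scale
  by unfold_locales (auto simp: pt_scale_def vec_eq_iff algebra_simps)

global_interpretation vf: vector_space vf_scale
  by unfold_locales (auto simp: vf_scale_def pt_scale_def vec_eq_iff algebra_simps fun_eq_iff)

global_interpretation cmat: vector_space mat_scale
  by unfold_locales (auto simp: mat_scale_def vec_eq_iff algebra_simps)

text \<open>Holomorphy in several variables: the real Frechet derivative exists and is complex linear for
  the complex scalar multiplications \<open>s1\<close>, \<open>s2\<close>. Only used on open sets.\<close>

definition holomorphic_map_on ::
    "(complex \<Rightarrow> 'a \<Rightarrow> 'a) \<Rightarrow> (complex \<Rightarrow> 'b \<Rightarrow> 'b) \<Rightarrow>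
     ('a::real_normed_vector \<Rightarrow> 'b::real_normed_vector) \<Rightarrow> 'a set \<Rightarrow> bool"
  where "holomorphic_map_on s1 s2 f S \<longleftrightarrow>
    (\<forall>x\<in>S. \<exists>f'. (f has_derivative f') (at x) \<and> Vector_Spaces.linear s1 s2 f')"

definition pd :: "'n::finite \<Rightarrow> (complex ^ 'n \<Rightarrow> complex) \<Rightarrow> complex ^ 'n \<Rightarrow> complex"
  where "pd i f x = deriv (\<lambda>h. f (x + axis i h)) 0"

definition grad :: "(complex ^ 'n::finite \<Rightarrow> complex) \<Rightarrow> complex ^ 'n \<Rightarrow> complex ^ 'n"
  where "grad f x = (\<chi> i. pd i f x)"

text \<open>The dependent variables are indexed by the finite type \<open>'m\<close>; \<open>one\<close> is the index of the
  distinguished dependent variable \<open>u\<^sup>1\<close>.\<close>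

definition solution ::
    "('m::finite \<Rightarrow> complex ^ 'n::finite ^ 'n) \<Rightarrow> 'm \<Rightarrow> (complex ^ 'n) set \<Rightarrow> (complex ^ 'n \<Rightarrow> complex ^ 'm) \<Rightarrow> bool"
  where "solution A one \<Omega> u \<longleftrightarrow>
    open \<Omega> \<and> connected \<Omega> \<and> holomorphic_map_on (*s) (*s) u \<Omega> \<and>
    (\<forall>x\<in>\<Omega>. \<forall>i j. pd j (pd i (\<lambda>y. u y $ one)) x = 0) \<and>
    (\<forall>x\<in>\<Omega>. \<forall>k. k \<noteq> one \<longrightarrow> grad (\<lambda>y. u y $ k) x = A k *v grad (\<lambda>y. u y $ one) x)"

definition graph_over :: "(complex ^ 'n::finite \<Rightarrow> complex ^ 'm::finite) \<Rightarrow> (complex ^ 'n) set \<Rightarrow> ('n, 'm) pt set"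
  where "graph_over u \<Omega> = (\<lambda>x. (x, u x)) ` \<Omega>"

text \<open>\<open>\<phi>\<close> is the flow of \<open>X\<close> with initial points in \<open>U\<close> and complex times with \<open>\<bar>t\<bar> < \<epsilon>\<close>.\<close>

definition local_flow ::
    "('n::finite, 'm::finite) vfield \<Rightarrow> ('n, 'm) pt set \<Rightarrow> ('n, 'm) pt set \<Rightarrow> real \<Rightarrow>
     (complex \<Rightarrow> ('n, 'm) pt \<Rightarrow> ('n, 'm) pt) \<Rightarrow> bool"
  where "local_flow X D U \<epsilon> \<phi> \<longleftrightarrow>
    (\<forall>p\<in>U. \<phi> 0 p = p \<and>
      (\<forall>t\<in>ball 0 \<epsilon>. \<phi> t p \<in> D \<and>
        ((\<lambda>s. \<phi> s p) has_derivative (\<lambda>h. pt_scale h (X (\<phi> t p)))) (at t)))"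

text \<open>The local flow of \<open>X\<close> maps graphs of solutions to graphs of solutions: near each point of the
  graph of a solution, and for small times, the (unique) flow exists and the image of a piece of the
  graph around that point is again the graph of a solution. The size of the piece and the time bound may
  depend on the solution and the point: the image of a large piece, or at a large time, need not
  be a graph at all.\<close>

definition infinitesimal_symmetry ::
    "('m::finite \<Rightarrow> complex ^ 'n::finite ^ 'n) \<Rightarrow> 'm \<Rightarrow> ('n, 'm) pt set \<Rightarrow> ('n, 'm) vfield \<Rightarrow> bool"
  where "infinitesimal_symmetry A one D X \<longleftrightarrow>
    holomorphic_map_on pt_scale pt_scale X D \<and>
    (\<forall>\<Omega> u. solution A one \<Omega> u \<and> graph_over u \<Omega> \<subseteq> D \<longrightarrow>
      (\<forall>x\<in>\<Omega>. \<exists>U W \<epsilon> \<phi>.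
        open U \<and> U \<subseteq> D \<and> open W \<and> x \<in> W \<and> W \<subseteq> \<Omega> \<and> graph_over u W \<subseteq> U \<and>
        \<epsilon> > 0 \<and> local_flow X D U \<epsilon> \<phi> \<and>
        (\<forall>t\<in>ball 0 \<epsilon>. \<exists>\<Omega>' v. solution A one \<Omega>' v \<and> \<phi> t ` graph_over u W = graph_over v \<Omega>')))"

text \<open>\<open>Lie_on A one D\<close> consists of the infinitesimal symmetries on \<open>D\<close>. A vector field on \<open>D\<close> is
  represented by its extension by \<open>0\<close>, so that equality of vector fields on \<open>D\<close> is equality of
  functions. \<open>Lie_at A one p\<close> collects the infinitesimal symmetries defined on some domain
  around \<open>p\<close>; these represent the germs at \<open>p\<close>.\<close>

definition Lie_on ::
    "('m::finite \<Rightarrow> complex ^ 'n::finite ^ 'n) \<Rightarrow> 'm \<Rightarrow> ('n, 'm) pt set \<Rightarrow> ('n, 'm) vfield set"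
  where "Lie_on A one D = {X. infinitesimal_symmetry A one D X \<and> (\<forall>p. p \<notin> D \<longrightarrow> X p = 0)}"

definition Lie_at ::
    "('m::finite \<Rightarrow> complex ^ 'n::finite ^ 'n) \<Rightarrow> 'm \<Rightarrow> ('n, 'm) pt \<Rightarrow> ('n, 'm) vfield set"
  where "Lie_at A one p = (\<Union>D\<in>{D. open D \<and> connected D \<and> p \<in> D}. Lie_on A one D)"

text \<open>Finite dimensionality over the complex numbers: spanned by finitely many elements. For germs at
  \<open>p\<close> this is understood modulo equality near \<open>p\<close>.\<close>

definition fin_dim :: "('n::finite, 'm::finite) vfield set \<Rightarrow> bool"
  where "fin_dim L \<longleftrightarrow> (\<exists>B. finite B \<and> B \<subseteq> L \<and> L \<subseteq> vf.span B)"

definition germs_fin_dim :: "('n::finite, 'm::finite) pt \<Rightarrow> ('n, 'm) vfield set \<Rightarrow> bool"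
  where "germs_fin_dim p L \<longleftrightarrow>
    (\<exists>B. finite B \<and> B \<subseteq> L \<and> (\<forall>X\<in>L. \<exists>Y\<in>vf.span B. \<forall>\<^sub>F z in nhds p. X z = Y z))"

end

(*
  Write L_b x = ((A^k b) . x)_k, so that the solutions are u = c + L_b x. Let X = (xi, eta) be a
  symmetry. Deforming a solution along the flow of X shows that the defect eta - L_b xi is affine
  along every line with direction (v, L_b v). Replacing b by b + s b' and differentiating at s = 0
  turns this, for all b', into: X is quadratic along every line with direction (v, L_b v).
  The linear independence of the A^k means precisely that these directions span the whole space.
  Choosing a basis among them, X is polynomial of degree at most 2 in each of the corresponding
  coordinates, hence lies in a fixed finite-dimensional space.
*)

theory Submission
  imports Defs "HOL-Complex_Analysis.Complex_Analysis"
begin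

text \<open>Two points shape the proof. First, the coefficients of a deformed solution are only
  known to exist for each time t, without any regularity in t. The difference quotient of the slope
  has to be shown bounded by comparing nearby points of the graph; only then is the defect a
  pointwise limit of affine functions. Second, passing from the defect to X takes two derivatives of
  the same affine identity. Let \<xi> be the x-part of X, e = (v, L_b v) and d = (0, L_b' v). Moving
  the base point along d shows that the derivative G of the defect in direction d is affine in t
  along z + t e. Replacing b by b + s b' moves z + t e by s t d and subtracts s L_b' \<xi> from the
  defect, so t G - L_b' \<xi> is affine as well. Hence L_b' \<xi> is quadratic, and its component of
  index 1 is the pairing of b' with \<xi>. Only first derivatives of X occur, because affine
  dependence is expressed through values at two points.\<close>

lemma norm_vec_scale: "norm (c *s v) = norm c * norm v" for v :: "complex ^ 'n::finite"
  by (simp add: norm_vec_def L2_set_right_distrib norm_mult)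

lemma norm_pt_scale: "norm (pt_scale c p) = norm c * norm p"
  by (simp add: pt_scale_def norm_vec_scale norm_prod_def power_mult_distrib
      flip: distrib_left real_sqrt_mult)
    (simp add: real_sqrt_mult)

lemma scaleR_eq_pt_scale: "r *\<^sub>R p = pt_scale (of_real r) p"
  by (simp add: pt_scale_def prod_eq_iff vec_eq_iff scaleR_conv_of_real[where 'a=complex])

subsection \<open>Solutions\<close>

lemma axis_eq_scale: "axis i s = s *s axis i (1::complex)"
  by (simp add: vec_eq_iff axis_def)

lemma axis_0: "axis i 0 = 0"
  by (simp add: axis_eq_0_iff)

lemma norm_axis: "norm (axis i s :: complex ^ 'n::finite) = norm s"
  by (simp add: norm_eq_sqrt_inner[of "axis i s"] inner_axis_axis norm_eq_sqrt_inner[of s])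

lemma scaleR_eq_scale: "r *\<^sub>R v = of_real r *s v" for v :: "complex ^ 'n"
  by (simp add: vec_eq_iff scaleR_conv_of_real[where 'a=complex])

lemma bounded_linear_scale_left: "bounded_linear (\<lambda>s. s *s v)" for v :: "complex ^ 'n::finite"
  by (rule bounded_linear_intro[where K = "norm v"])
    (simp_all add: vec_eq_iff scaleR_conv_of_real[where 'a=complex] algebra_simps norm_vec_scale)

lemma bounded_linear_axis: "bounded_linear (axis i :: complex \<Rightarrow> complex ^ 'n::finite)"
proof -
  have "axis i = (\<lambda>s. s *s axis i (1 :: complex))" by (rule ext) (rule axis_eq_scale)
  then show ?thesis by (rule ssubst) (rule bounded_linear_scale_left)
qed

text \<open>This is L_b of the overview: component k is the linear form with gradient
  \<open>A k *v b\<close>. The pairing is a plain sum without conjugation, so it is complex linear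
  in both \<open>b\<close> and \<open>x\<close>.\<close>

definition slope :: "('m::finite \<Rightarrow> complex ^ 'n::finite ^ 'n) \<Rightarrow> complex ^ 'n \<Rightarrow> complex ^ 'n \<Rightarrow> complex ^ 'm"
  where "slope A b x = (\<chi> k. \<Sum>i\<in>UNIV. (A k *v b) $ i * x $ i)"

lemma slope_scale_left: "slope A (c *s b) x = c *s slope A b x"
  by (simp add: slope_def vec_eq_iff vector_scalar_commute sum_distrib_left mult.assoc)

lemma slope_scale_right: "slope A b (c *s x) = c *s slope A b x"
  by (simp add: slope_def vec_eq_iff sum_distrib_left mult.left_commute)

lemma bounded_bilinear_slope: "bounded_bilinear (slope A)"
proof -
  have "bilinear (slope A)"
    unfolding bilinear_def
    by (intro conjI allI linearI)
      (simp_all add: scaleR_eq_scale slope_scale_left slope_scale_right,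
        simp_all add: slope_def vec_eq_iff matrix_vector_right_distrib algebra_simps sum.distrib)
  then show ?thesis by (simp add: bilinear_conv_bounded_bilinear)
qed

interpretation slope: bounded_bilinear "slope A" for A
  by (rule bounded_bilinear_slope)

lemma slope_one: "A one = mat 1 \<Longrightarrow> slope A b x $ one = (\<Sum>i\<in>UNIV. b $ i * x $ i)"
  by (simp add: slope_def)

lemma slope_axis: "slope A b (axis i 1) $ k = (A k *v b) $ i"
  by (simp add: slope_def axis_def if_distrib cong: if_cong)

lemma has_field_derivative_along_axis:
  fixes f :: "complex ^ 'n::finite \<Rightarrow> complex"
  assumes "(f has_derivative f') (at (x + axis i h))" "Vector_Spaces.linear (*s) (*) f'"
  shows "((\<lambda>s. f (x + axis i s)) has_field_derivative f' (axis i 1)) (at h)"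
proof -
  have "((\<lambda>s. x + axis i s) has_derivative (\<lambda>s. axis i s)) (at h)"
    using has_derivative_add[OF has_derivative_const bounded_linear_imp_has_derivative[OF bounded_linear_axis]]
    by simp
  from has_derivative_compose[OF this assms(1)]
  have "((\<lambda>s. f (x + axis i s)) has_derivative (\<lambda>s. f' (axis i s))) (at h)" .
  moreover have "(\<lambda>s. f' (axis i s)) = (*) (f' (axis i 1))"
    using assms(2) by (subst axis_eq_scale) (simp add: Vector_Spaces.linear_iff fun_eq_iff)
  ultimately show ?thesis unfolding has_field_derivative_def by (rule back_subst)
qed

text \<open>Both sides are the same \<open>deriv\<close> expression after a shift of the parameter,
  so no differentiability is involved.\<close>

lemma deriv_along_axis: "deriv (\<lambda>s. f (x + axis i s)) h = pd i f (x + axis i h)"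
proof -
  have "axis i (h + s) = axis i h + axis i s" for s :: complex
    by (simp add: axis_def vec_eq_iff)
  then show ?thesis
    by (subst deriv_shift_0) (simp add: pd_def o_def add.assoc)
qed

section \<open>Functions with vanishing second partial derivatives\<close>

locale flat_function =
  fixes f :: "complex ^ 'n::finite \<Rightarrow> complex" and \<Omega>
  assumes open_dom: "open \<Omega>"
    and holo: "holomorphic_map_on (*s) (*) f \<Omega>"
    and flat: "\<And>x i j. x \<in> \<Omega> \<Longrightarrow> pd j (pd i f) x = 0"
begin

lemma pd_has_field_derivative:
  assumes "x + axis i h \<in> \<Omega>"
  shows "((\<lambda>s. f (x + axis i s)) has_field_derivative pd i f (x + axis i h)) (at h)"
proof -
  obtain f' where "(f has_derivative f') (at (x + axis i h))" "Vector_Spaces.linear (*s) (*) f'"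
    using assms holo unfolding holomorphic_map_on_def by blast
  then have *: "((\<lambda>s. f (x + axis i s)) has_field_derivative f' (axis i 1)) (at h)"
    by (rule has_field_derivative_along_axis)
  show ?thesis using * DERIV_imp_deriv[OF *] deriv_along_axis[of f x i h] by simp
qed

lemma convex_open_line:
  fixes R :: "(complex ^ 'n) set"
  assumes "convex R" "open R"
  shows "convex {s. x + axis i s \<in> R}" "open {s. x + axis i s \<in> R}"
proof -
  interpret axis: bounded_linear "axis i :: complex \<Rightarrow> complex ^ 'n" by (rule bounded_linear_axis)
  show "convex {s. x + axis i s \<in> R}"
  proof (rule convexI)
    fix s t and a b :: real
    assume st: "s \<in> {s. x + axis i s \<in> R}" "t \<in> {s. x + axis i s \<in> R}" and ab: "0 \<le> a" "0 \<le> b" "a + b = 1"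
    have "a *\<^sub>R (x + axis i s) + b *\<^sub>R (x + axis i t) = (a + b) *\<^sub>R x + axis i (a *\<^sub>R s + b *\<^sub>R t)"
      unfolding axis.add axis.scaleR scaleR_right_distrib scaleR_left_distrib by (simp only: add_ac)
    then show "a *\<^sub>R s + b *\<^sub>R t \<in> {s. x + axis i s \<in> R}"
      using convexD[OF assms(1), of "x + axis i s" "x + axis i t" a b] st ab by simp
  qed
  show "open {s. x + axis i s \<in> R}"
    using open_vimage[OF assms(2), of "\<lambda>s. x + axis i s"]
    by (simp add: vimage_def continuous_on_add linear_continuous_on[OF bounded_linear_axis])
qed

text \<open>Only flatness with j = i enters. On a line parallel to axis i the function is
  holomorphic in one variable, so its derivative is holomorphic too and the vanishing
  \<open>deriv\<close> is a genuine second derivative.\<close>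

lemma affine_along_axis:
  assumes R: "convex R" "open R" "R \<subseteq> \<Omega>" and x: "x \<in> R" "x + axis i k \<in> R"
  shows "f (x + axis i k) = f x + k * pd i f x"
proof -
  let ?S = "{s. x + axis i s \<in> R}" and ?g = "\<lambda>s. f (x + axis i s)"
  have dom: "x + axis i s \<in> \<Omega>" if "s \<in> ?S" for s using that R(3) by auto
  have holo: "?g holomorphic_on ?S"
    unfolding holomorphic_on_def field_differentiable_def
    by (intro ballI exI) (rule has_field_derivative_at_within[OF pd_has_field_derivative[OF dom]])
  have "(deriv ?g has_field_derivative 0) (at s)" if s: "s \<in> ?S" for s
  proof -
    have "deriv (deriv ?g) s = deriv (\<lambda>s. pd i f (x + axis i s)) s"
      by (simp add: deriv_along_axis[abs_def])
    also have "\<dots> = 0" using flat[OF dom[OF s]] by (simp add: deriv_along_axis)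
    finally show ?thesis
      using holomorphic_derivI[OF holomorphic_deriv[OF holo convex_open_line(2)[OF R(1,2)]]
          convex_open_line(2)[OF R(1,2)] s] by simp
  qed
  then have "\<exists>c. \<forall>s\<in>?S. deriv ?g s = c"
    by (intro has_field_derivative_zero_constant[OF convex_open_line(1)[OF R(1,2)]])
      (rule has_field_derivative_at_within)
  then obtain c where c: "\<And>s. s \<in> ?S \<Longrightarrow> deriv ?g s = c" by auto
  have 0: "0 \<in> ?S" "k \<in> ?S" using x by (simp_all add: axis_0)
  have "\<exists>d. \<forall>s\<in>?S. ?g s - s * c = d"
  proof (rule has_field_derivative_zero_constant[OF convex_open_line(1)[OF R(1,2)]])
    fix s assume s: "s \<in> ?S"
    have "(?g has_field_derivative c) (at s)"
      using pd_has_field_derivative[OF dom[OF s]] c[OF s] by (simp add: deriv_along_axis)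
    then have "((\<lambda>s. ?g s - s * c) has_field_derivative 0) (at s)"
      by (auto intro!: derivative_eq_intros)
    then show "((\<lambda>s. ?g s - s * c) has_field_derivative 0) (at s within ?S)"
      by (rule has_field_derivative_at_within)
  qed
  then obtain d where "\<forall>s\<in>?S. ?g s - s * c = d" ..
  then have "?g k - k * c = d" "?g 0 - 0 * c = d" using 0 by blast+
  moreover have "c = pd i f x" using c[OF 0(1)] by (simp add: deriv_along_axis axis_0)
  ultimately show ?thesis by (simp add: axis_0 algebra_simps)
qed

text \<open>As \<open>f\<close> is affine along the \<open>i\<close>-axis, \<open>pd i f\<close> is a difference quotient of \<open>f\<close> and hence
  holomorphic along the \<open>j\<close>-axis, so that \<open>pd j (pd i f) = 0\<close> really means a vanishing derivative
  and not just the arbitrary value of \<^const>\<open>deriv\<close> at a point of non-differentiability.\<close>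

lemma pd_has_field_derivative_0:
  assumes "x \<in> \<Omega>"
  shows "((\<lambda>h. pd i f (x + axis j h)) has_field_derivative 0) (at 0)"
proof -
  obtain d where d: "d > 0" "ball x d \<subseteq> \<Omega>" using open_dom assms openE by blast
  \<comment> \<open>Half the radius, so that a shift by \<open>axis i k\<close> followed by one of
    length less than \<open>d / 2\<close> along axis j stays in the ball.\<close>
  define k :: complex where "k = of_real (d / 2)"
  have k: "k \<noteq> 0" "norm k = d / 2" using d by (simp_all add: k_def)
  have eq: "(f (x + axis i k + axis j h) - f (x + axis j h)) / k = pd i f (x + axis j h)"
    if "h \<in> ball 0 (d / 2)" for h
  proof -
    have "norm (axis j h + axis i k :: complex ^ 'n) < d"
      using norm_triangle_ineq[of "axis j h" "axis i k"] that k by (simp add: norm_axis)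
    moreover have "- axis j h - axis i k = - (axis j h + axis i k :: complex ^ 'n)" by simp
    ultimately have "norm (- axis j h - axis i k :: complex ^ 'n) < d" by (simp only: norm_minus_cancel)
    then have "f (x + axis j h + axis i k) = f (x + axis j h) + k * pd i f (x + axis j h)"
      using that d by (intro affine_along_axis[of "ball x d"]) (auto simp: dist_norm add.assoc norm_axis)
    then show ?thesis using k by (simp add: field_simps add_ac)
  qed
  have "x + axis i k \<in> \<Omega>" using d k by (intro subsetD[OF d(2)]) (auto simp: dist_norm norm_axis)
  then have 1: "((\<lambda>h. f (x + axis i k + axis j h)) has_field_derivative pd j f (x + axis i k)) (at 0)"
    using pd_has_field_derivative[of "x + axis i k" j 0] by (simp add: axis_0)
  have 2: "((\<lambda>h. f (x + axis j h)) has_field_derivative pd j f x) (at 0)"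
    using pd_has_field_derivative[of x j 0] assms by (simp add: axis_0)
  have "((\<lambda>h. (f (x + axis i k + axis j h) - f (x + axis j h)) / k) has_field_derivative
      (pd j f (x + axis i k) - pd j f x) / k) (at 0)"
    by (intro DERIV_cdivide DERIV_diff 1 2)
  then have *: "((\<lambda>h. pd i f (x + axis j h)) has_field_derivative
      (pd j f (x + axis i k) - pd j f x) / k) (at 0)"
    by (rule has_field_derivative_transform_within_open[OF _ open_ball[of 0 "d / 2"]])
      (use d eq in auto)
  have D: "(pd j f (x + axis i k) - pd j f x) / k = 0"
    using DERIV_imp_deriv[OF *] flat[OF assms, of j i] by (simp add: pd_def[of j])
  show ?thesis using * unfolding D .
qed

lemma pd_constant_along_axis:
  assumes R: "convex R" "open R" "R \<subseteq> \<Omega>" and x: "x \<in> R" "x + axis j k \<in> R"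
  shows "pd i f (x + axis j k) = pd i f x"
proof -
  let ?S = "{s. x + axis j s \<in> R}"
  have add: "axis j (h + s) = axis j h + (axis j s :: complex ^ 'n)" for h s
    by (simp add: axis_def vec_eq_iff)
  have "\<exists>c. \<forall>s\<in>?S. pd i f (x + axis j s) = c"
  proof (rule has_field_derivative_zero_constant[OF convex_open_line(1)[OF R(1,2)]])
    fix s assume "s \<in> ?S"
    then have "x + axis j s \<in> \<Omega>" using R by auto
    from pd_has_field_derivative_0[OF this, of i j]
    have "((\<lambda>h. pd i f (x + axis j (s + h))) has_field_derivative 0) (at 0)"
      by (simp add: add add.assoc)
    then have "((\<lambda>h. pd i f (x + axis j h)) has_field_derivative 0) (at s)"
      using DERIV_shift[of "\<lambda>h. pd i f (x + axis j h)" 0 0 s] by (simp only: add.commute[of s] add_0)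
    then show "((\<lambda>h. pd i f (x + axis j h)) has_field_derivative 0) (at s within ?S)"
      by (rule has_field_derivative_at_within)
  qed
  then obtain c where "\<forall>s\<in>?S. pd i f (x + axis j s) = c" ..
  moreover have "0 \<in> ?S" "k \<in> ?S" using x by (simp_all add: axis_0)
  ultimately have "pd i f (x + axis j k) = c" "pd i f (x + axis j 0) = c" by blast+
  then show ?thesis by (simp add: axis_0)
qed

lemma pd_constant_on_ball:
  assumes "ball x d \<subseteq> \<Omega>" "z \<in> ball x d"
  shows "pd i f z = pd i f x"
proof -
  \<comment> \<open>The coordinates of \<open>x\<close> are replaced by those of \<open>z\<close>
    one at a time. Every intermediate point is componentwise at most as far from \<open>x\<close> as
    \<open>z\<close> is, hence stays in the ball.\<close>
  define y where "y T = x + (\<chi> j. if j \<in> T then z $ j - x $ j else 0)" for T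
  have y_in: "y T \<in> ball x d" for T
  proof -
    have "norm (y T - x) \<le> norm (z - x)"
      unfolding y_def by (rule norm_le_componentwise_cart) auto
    then show ?thesis using assms(2) by (simp add: dist_norm norm_minus_commute)
  qed
  have "pd i f (y T) = pd i f x" for T
    using finite[of T]
  proof (induction T rule: finite_induct)
    case empty
    have "y {} = x" by (simp add: y_def vec_eq_iff)
    then show ?case by simp
  next
    case (insert j T)
    have "y (insert j T) = y T + axis j (z $ j - x $ j)"
      using insert by (auto simp: y_def vec_eq_iff axis_def)
    then show ?case
      using pd_constant_along_axis[OF convex_ball open_ball assms(1) y_in[of T], of j "z $ j - x $ j" i]
        y_in[of "insert j T"] insert.IH by simp
  qed
  from this[of UNIV] have "pd i f (y UNIV) = pd i f x" .
  moreover have "y UNIV = z" by (simp add: y_def vec_eq_iff)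
  ultimately show ?thesis by simp
qed

lemma grad_constant:
  assumes "connected \<Omega>"
  obtains b where "\<And>x. x \<in> \<Omega> \<Longrightarrow> grad f x = b"
proof -
  have "grad f constant_on \<Omega>"
  proof (rule locally_constant_imp_constant[OF assms])
    fix x assume x: "x \<in> \<Omega>"
    obtain d where d: "d > 0" "ball x d \<subseteq> \<Omega>" using open_dom x openE by blast
    then have "grad f y = grad f x" if "y \<in> ball x d" for y
      using pd_constant_on_ball[OF d(2) that] by (simp add: grad_def)
    moreover have "openin (top_of_set \<Omega>) (ball x d)" using d(2) open_ball by (rule open_subset)
    moreover have "x \<in> ball x d" using d(1) by simp
    ultimately show "\<exists>T. openin (top_of_set \<Omega>) T \<and> x \<in> T \<and> (\<forall>y\<in>T. grad f y = grad f x)"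
      by blast
  qed
  then show thesis using that unfolding constant_on_def by blast
qed

end

lemma grad_eqI:
  fixes f :: "complex ^ 'n::finite \<Rightarrow> complex"
  assumes "(f has_derivative f') (at x)" "Vector_Spaces.linear (*s) (*) f'"
  shows "grad f x = (\<chi> i. f' (axis i 1))"
proof -
  have "pd i f x = f' (axis i 1)" for i
    using has_field_derivative_along_axis[of f f' x i 0] assms unfolding pd_def
    by (intro DERIV_imp_deriv) (simp add: axis_0)
  then show ?thesis by (simp add: grad_def)
qed

lemma linear_component:
  fixes f :: "complex ^ 'n::finite \<Rightarrow> complex ^ 'm::finite"
  assumes "Vector_Spaces.linear (*s) (*s) f"
  shows "Vector_Spaces.linear (*s) (*) (\<lambda>v. f v $ k)"
proof -
  have "vector_space ((*) :: complex \<Rightarrow> _)"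
    by unfold_locales (simp_all add: algebra_simps)
  then show ?thesis using assms by (simp add: Vector_Spaces.linear_iff)
qed

text \<open>Flatness makes the gradient of component \<open>one\<close> a constant \<open>b\<close>,
  and the first-order equations then fix all other gradients. So \<open>u\<close> and
  \<open>slope A b\<close> have the same derivative, and connectedness makes their difference
  constant.\<close>

lemma solution_imp_affine:
  fixes A :: "'m::finite \<Rightarrow> complex ^ 'n::finite ^ 'n"
  assumes one: "A one = mat 1" and sol: "solution A one \<Omega> u"
  shows "\<exists>c b. \<forall>x\<in>\<Omega>. u x = c + slope A b x"
proof (cases "\<Omega> = {}")
  case False
  then obtain x0 where x0: "x0 \<in> \<Omega>" by blast
  have \<Omega>: "open \<Omega>" "connected \<Omega>" using sol by (auto simp: solution_def)
  have "holomorphic_map_on (*s) (*s) u \<Omega>" using sol by (auto simp: solution_def)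
  then obtain u' where u': "\<And>x. x \<in> \<Omega> \<Longrightarrow> (u has_derivative u' x) (at x)"
    "\<And>x. x \<in> \<Omega> \<Longrightarrow> Vector_Spaces.linear (*s) (*s) (u' x)"
    unfolding holomorphic_map_on_def by metis
  have comp: "((\<lambda>y. u y $ k) has_derivative (\<lambda>v. u' x v $ k)) (at x)" if "x \<in> \<Omega>" for x k
    by (rule bounded_linear.has_derivative[OF bounded_linear_vec_nth u'(1)[OF that]])
  interpret flat_function "\<lambda>y. u y $ one" \<Omega>
  proof
    show "open \<Omega>" by (rule \<Omega>)
    show "holomorphic_map_on (*s) (*) (\<lambda>y. u y $ one) \<Omega>"
      unfolding holomorphic_map_on_def using comp linear_component[OF u'(2)] by blast
    show "pd j (pd i (\<lambda>y. u y $ one)) x = 0" if "x \<in> \<Omega>" for x i j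
      using sol that by (simp add: solution_def)
  qed
  obtain b where b: "\<And>x. x \<in> \<Omega> \<Longrightarrow> grad (\<lambda>y. u y $ one) x = b" using grad_constant \<Omega> by blast
  have grad: "grad (\<lambda>y. u y $ k) x = A k *v b" if "x \<in> \<Omega>" for x k
    using sol that b one by (cases "k = one") (auto simp: solution_def)
  have u'_eq: "u' x = slope A b" if x: "x \<in> \<Omega>" for x
  proof (rule ext)
    fix v
    interpret u': Vector_Spaces.linear "(*s)" "(*s)" "u' x" by (rule u'(2)[OF x])
    have "u' x (axis i 1) $ k = (A k *v b) $ i" for i k
      using grad[OF x, of k] grad_eqI[OF comp[OF x] linear_component[OF u'(2)[OF x]], of k]
      by (auto simp: vec_eq_iff)
    then have "u' x (\<Sum>i\<in>UNIV. v $ i *s axis i 1) $ k = slope A b v $ k" for k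
      by (simp add: u'.sum u'.scale slope_def mult.commute)
    then show "u' x v = slope A b v" by (simp add: basis_expansion vec_eq_iff)
  qed
  have "((\<lambda>y. u y - slope A b y) has_derivative (\<lambda>_. 0)) (at x)" if x: "x \<in> \<Omega>" for x
    using has_derivative_diff[OF u'(1)[OF x]
        bounded_linear_imp_has_derivative[OF slope.bounded_linear_right[of A b]]]
    by (simp add: u'_eq[OF x])
  then have "u x - slope A b x = u x0 - slope A b x0" if "x \<in> \<Omega>" for x
    using has_derivative_zero_unique_connected[OF \<Omega> _ that x0] by blast
  then have "\<forall>x\<in>\<Omega>. u x = (u x0 - slope A b x0) + slope A b x"
    by (metis diff_add_cancel)
  then show ?thesis by blast
qed simp

text \<open>These are the test solutions: through every point there is one with any prescribed
  \<open>b\<close>.\<close>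

lemma affine_imp_solution:
  fixes A :: "'m::finite \<Rightarrow> complex ^ 'n::finite ^ 'n"
  assumes one: "A one = mat 1" and "open \<Omega>" "connected \<Omega>"
  shows "solution A one \<Omega> (\<lambda>x. c + slope A b x)"
proof -
  have der: "((\<lambda>x. c + slope A b x) has_derivative slope A b) (at x)" for x
    using has_derivative_add[OF has_derivative_const
        bounded_linear_imp_has_derivative[OF slope.bounded_linear_right[of A b]]]
    by simp
  have lin: "Vector_Spaces.linear (*s) (*s) (slope A b)"
    by (simp add: Vector_Spaces.linear_iff slope.add_right slope_scale_right vec.vector_space_axioms)
  have grad: "grad (\<lambda>y. (c + slope A b y) $ k) x = A k *v b" for k x
    using grad_eqI[OF bounded_linear.has_derivative[OF bounded_linear_vec_nth der] linear_component[OF lin]]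
    by (simp add: slope_axis)
  have "pd i (\<lambda>y. (c + slope A b y) $ one) = (\<lambda>_. b $ i)" for i
    using grad[of one] one by (simp add: grad_def vec_eq_iff fun_eq_iff)
  then have "pd j (pd i (\<lambda>y. (c + slope A b y) $ one)) x = 0" for i j x
    by (simp add: pd_def[of j])
  moreover have "holomorphic_map_on (*s) (*s) (\<lambda>x. c + slope A b x) \<Omega>"
    unfolding holomorphic_map_on_def using der lin by blast
  ultimately show ?thesis
    unfolding solution_def grad one using assms(2,3) by simp
qed

subsection \<open>Deformations of solutions under the flow\<close>

text \<open>Time is complex, so the quotient is taken with \<open>pt_scale\<close>. Its distance to
  \<open>X\<close> is exactly the remainder of the Frechet derivative divided by the norm of the
  increment.\<close>

lemma flow_difference_quotient:
  fixes f :: "complex \<Rightarrow> ('n::finite, 'm::finite) pt"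
  assumes "(f has_derivative (\<lambda>h. pt_scale h X)) (at 0)"
  shows "((\<lambda>t. pt_scale (1 / t) (f t - f 0)) \<longlongrightarrow> X) (at 0)"
proof -
  have "((\<lambda>h. norm (f (0 + h) - f 0 - pt_scale h X) / norm h) \<longlongrightarrow> 0) (at 0)"
    using assms unfolding has_derivative_at by blast
  moreover have "\<forall>\<^sub>F h in at 0. norm (f (0 + h) - f 0 - pt_scale h X) / norm h
      = norm (pt_scale (1 / h) (f h - f 0) - X)"
  proof -
    have "norm (f (0 + h) - f 0 - pt_scale h X) / norm h = norm (pt_scale (1 / h) (f h - f 0) - X)"
      if "h \<noteq> 0" for h
    proof -
      have "pt_scale (1 / h) (f h - f 0) - X = pt_scale (1 / h) (f h - f 0 - pt_scale h X)"
        using that by (simp add: pt.scale_right_diff_distrib)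
      then show ?thesis by (simp add: norm_pt_scale norm_divide)
    qed
    then show ?thesis unfolding eventually_at_filter by (intro always_eventually allI impI) blast
  qed
  ultimately have "((\<lambda>h. norm (pt_scale (1 / h) (f h - f 0) - X)) \<longlongrightarrow> 0) (at 0)"
    by (rule Lim_transform_eventually)
  then show ?thesis
    using tendsto_norm_zero_iff LIM_zero_iff by blast
qed

lemma norm_vec_le_sum: "norm (v :: complex ^ 'n::finite) \<le> (\<Sum>i\<in>UNIV. norm (v $ i))"
  unfolding norm_vec_def by (rule L2_set_le_sum) simp

text \<open>The vectors \<open>M i t\<close> are the rows of a matrix tending to s times the
  identity, and the products of this matrix with \<open>\<beta> t\<close> converge. The deviation
  \<open>E t\<close> is eventually below half of \<open>norm s\<close>, so its contribution is
  absorbed on the left, which bounds \<open>\<beta>\<close>.\<close>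

lemma Bfun_of_almost_identity:
  fixes \<beta> :: "'a \<Rightarrow> complex ^ 'n::finite" and M :: "'n \<Rightarrow> 'a \<Rightarrow> complex ^ 'n"
  assumes s: "s \<noteq> 0" and M: "\<And>i. ((\<lambda>t. M i t) \<longlongrightarrow> axis i s) F"
    and R: "\<And>i. ((\<lambda>t. \<Sum>j\<in>UNIV. \<beta> t $ j * M i t $ j) \<longlongrightarrow> \<rho> i) F"
  shows "Bfun \<beta> F"
proof -
  define E where "E t = (\<Sum>i\<in>UNIV. \<Sum>j\<in>UNIV. norm (M i t $ j - axis i s $ j))" for t
  define Q where "Q t = (\<Sum>i\<in>UNIV. norm (\<Sum>j\<in>UNIV. \<beta> t $ j * M i t $ j))" for t
  have "(E \<longlongrightarrow> (\<Sum>i\<in>(UNIV::'n set). \<Sum>j\<in>(UNIV::'n set). norm (axis i s $ j - axis i s $ j))) F"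
    unfolding E_def by (intro tendsto_intros M)
  then have "(E \<longlongrightarrow> 0) F" by simp
  then have E: "\<forall>\<^sub>F t in F. E t < norm s / 2"
    using s by (intro order_tendstoD) auto
  \<comment> \<open>The summand 1 puts the limit of \<open>Q\<close> strictly below
    \<open>K\<close>.\<close>
  define K where "K = (\<Sum>i\<in>UNIV. norm (\<rho> i)) + 1"
  have "(Q \<longlongrightarrow> (\<Sum>i\<in>UNIV. norm (\<rho> i))) F"
    unfolding Q_def by (intro tendsto_intros R)
  then have Q: "\<forall>\<^sub>F t in F. Q t < K"
    by (rule order_tendstoD) (simp add: K_def)
  show ?thesis
  proof (rule BfunI)
    show "\<forall>\<^sub>F t in F. norm (\<beta> t) \<le> 2 * K / norm s"
      using E Q
    proof eventually_elim
      case (elim t)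
      have "norm s * norm (\<beta> t $ i) \<le> norm (\<Sum>j\<in>UNIV. \<beta> t $ j * M i t $ j)
          + (\<Sum>j\<in>UNIV. norm (M i t $ j - axis i s $ j)) * norm (\<beta> t)" for i
      proof -
        have "(\<Sum>j\<in>UNIV. \<beta> t $ j * axis i s $ j) = \<beta> t $ i * s"
          by (simp add: axis_def if_distrib cong: if_cong)
        then have "s * \<beta> t $ i = (\<Sum>j\<in>UNIV. \<beta> t $ j * M i t $ j)
            - (\<Sum>j\<in>UNIV. \<beta> t $ j * (M i t $ j - axis i s $ j))"
          by (simp add: algebra_simps sum_subtractf)
        then have "norm s * norm (\<beta> t $ i) \<le> norm (\<Sum>j\<in>UNIV. \<beta> t $ j * M i t $ j)
            + norm (\<Sum>j\<in>UNIV. \<beta> t $ j * (M i t $ j - axis i s $ j))"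
          by (metis norm_mult norm_triangle_ineq4)
        also have "norm (\<Sum>j\<in>UNIV. \<beta> t $ j * (M i t $ j - axis i s $ j))
            \<le> (\<Sum>j\<in>UNIV. norm (\<beta> t) * norm (M i t $ j - axis i s $ j))"
          by (rule sum_norm_le) (auto simp: norm_mult intro!: mult_right_mono Finite_Cartesian_Product.norm_nth_le)
        also have "\<dots> = (\<Sum>j\<in>UNIV. norm (M i t $ j - axis i s $ j)) * norm (\<beta> t)"
          by (simp add: sum_distrib_left mult.commute)
        finally show ?thesis by simp
      qed
      then have "(\<Sum>i\<in>UNIV. norm s * norm (\<beta> t $ i)) \<le> (\<Sum>i\<in>UNIV. norm (\<Sum>j\<in>UNIV. \<beta> t $ j * M i t $ j)
          + (\<Sum>j\<in>UNIV. norm (M i t $ j - axis i s $ j)) * norm (\<beta> t))"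
        by (rule sum_mono)
      also have "\<dots> = Q t + E t * norm (\<beta> t)"
        by (simp add: Q_def E_def sum.distrib sum_distrib_right)
      also have "\<dots> \<le> K + norm s / 2 * norm (\<beta> t)"
        using elim by (intro add_mono mult_right_mono) auto
      finally have "norm s * norm (\<beta> t) \<le> K + norm s / 2 * norm (\<beta> t)"
        using mult_left_mono[OF norm_vec_le_sum[of "\<beta> t"], of "norm s"]
        by (simp add: sum_distrib_left)
      then show ?case using s by (simp add: field_simps)
    qed
  qed
qed

text \<open>The characteristic of X on solutions of slope \<open>b\<close>: the vertical velocity at
  which the flow initially moves the graph of such a solution.\<close>

definition defect where "defect A b X z = snd (X z) - slope A b (fst (X z))"

text \<open>An affine function of s takes at s a fixed combination of its values at 0 and
  \<open>h\<close>, and this relation passes to the limit.\<close>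

lemma affine_limit:
  fixes \<gamma> \<beta> :: "complex \<Rightarrow> complex ^ 'n::finite" and w :: "complex \<Rightarrow> complex ^ 'n"
  assumes lim: "\<And>s. norm s < r \<Longrightarrow> ((\<lambda>t. \<gamma> t + s *s \<beta> t) \<longlongrightarrow> w s) (at 0)" and "r > 0"
  shows "\<exists>d. \<forall>s. norm s < r \<longrightarrow> w s = w 0 + s *s d"
proof -
  define h :: complex where "h = of_real (r / 2)"
  have h: "norm h < r" "h \<noteq> 0" using \<open>r > 0\<close> by (auto simp: h_def)
  have "w s = w 0 + s *s ((1 / h) *s (w h - w 0))" if s: "norm s < r" for s
  proof (rule tendsto_unique[OF _ lim[OF s]])
    have scale: "((\<lambda>t. c *s g t) \<longlongrightarrow> c *s l) (at 0)" if "(g \<longlongrightarrow> l) (at 0)"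
      for c :: complex and g :: "complex \<Rightarrow> complex ^ 'n" and l
      using that by (intro vec_tendstoI) (auto intro!: tendsto_intros)
    have "((\<lambda>t. (\<gamma> t + 0 *s \<beta> t) + s *s ((1 / h) *s ((\<gamma> t + h *s \<beta> t) - (\<gamma> t + 0 *s \<beta> t))))
        \<longlongrightarrow> w 0 + s *s ((1 / h) *s (w h - w 0))) (at 0)"
      using h \<open>r > 0\<close> by (intro tendsto_add tendsto_diff scale lim) auto
    then show "((\<lambda>t. \<gamma> t + s *s \<beta> t) \<longlongrightarrow> w 0 + s *s ((1 / h) *s (w h - w 0))) (at 0)"
      using h by (simp add: vector_smult_assoc)
  qed simp
  then show ?thesis by blast
qed

text \<open>The moved graph lies in the graph of \<open>c1 t + slope A (b1 t)\<close>. Dividing the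
  change of the coefficients by t and letting t tend to 0 exhibits the defect as a limit of affine
  functions of the base point. The difficulty is that the flow also moves the base point.\<close>

lemma defect_affine_local:
  fixes A :: "'m::finite \<Rightarrow> complex ^ 'n::finite ^ 'n"
  assumes one: "A one = mat 1"
    and W: "open W" "x \<in> W"
    and u: "\<And>y. u y = c + slope A b y"
    and \<epsilon>: "\<epsilon> > 0"
    and \<phi>0: "\<And>y. y \<in> W \<Longrightarrow> \<phi> 0 (y, u y) = (y, u y)"
    and \<phi>': "\<And>y. y \<in> W \<Longrightarrow> ((\<lambda>s. \<phi> s (y, u y)) has_derivative (\<lambda>h. pt_scale h (X (y, u y)))) (at 0)"
    and aff: "\<And>t. t \<in> ball 0 \<epsilon> \<Longrightarrow>
      \<exists>c b. \<forall>y\<in>W. snd (\<phi> t (y, u y)) = c + slope A b (fst (\<phi> t (y, u y)))"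
  shows "\<exists>r>0. \<exists>d. \<forall>s. norm s < r \<longrightarrow> x + s *s v \<in> W \<and>
    defect A b X (x + s *s v, u (x + s *s v)) = defect A b X (x, u x) + s *s d"
proof -
  have "\<forall>t\<in>ball 0 \<epsilon>. \<exists>c b. \<forall>y\<in>W. snd (\<phi> t (y, u y)) = c + slope A b (fst (\<phi> t (y, u y)))"
    using aff by blast
  from bchoice[OF this] obtain c1 where
    "\<forall>t\<in>ball 0 \<epsilon>. \<exists>b. \<forall>y\<in>W. snd (\<phi> t (y, u y)) = c1 t + slope A b (fst (\<phi> t (y, u y)))" ..
  from bchoice[OF this] obtain b1 where cb:
    "\<forall>t\<in>ball 0 \<epsilon>. \<forall>y\<in>W. snd (\<phi> t (y, u y)) = c1 t + slope A (b1 t) (fst (\<phi> t (y, u y)))" ..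
  define \<gamma> where "\<gamma> t = (1 / t) *s (c1 t - c)" for t
  define \<beta> where "\<beta> t = (1 / t) *s (b1 t - b)" for t
  let ?w = "\<lambda>y. defect A b X (y, u y)"
  have q: "((\<lambda>t. fst (\<phi> t (y, u y))) \<longlongrightarrow> y) (at 0)" if "y \<in> W" for y
    using has_derivative_continuous[OF \<phi>'[OF that]] \<phi>0[OF that] tendsto_fst
    by (fastforce simp: continuous_within)
  \<comment> \<open>The difference quotient of the flow is inserted into the defect. The affine
    equations for the moved and the original point turn it into an expression in
    \<open>\<gamma>\<close> and \<open>\<beta>\<close>, still evaluated at the moved base
    point.\<close>
  have N: "((\<lambda>t. \<gamma> t + slope A (\<beta> t) (fst (\<phi> t (y, u y)))) \<longlongrightarrow> ?w y) (at 0)" if y: "y \<in> W" for y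
  proof (rule Lim_transform_eventually)
    let ?D = "\<lambda>t. pt_scale (1 / t) (\<phi> t (y, u y) - \<phi> 0 (y, u y))"
    have D: "(?D \<longlongrightarrow> X (y, u y)) (at 0)" by (rule flow_difference_quotient[OF \<phi>'[OF y]])
    show "((\<lambda>t. snd (?D t) - slope A b (fst (?D t))) \<longlongrightarrow> ?w y) (at 0)"
      unfolding defect_def by (intro tendsto_intros slope.tendsto D)
    have "\<forall>\<^sub>F t in at 0. t \<in> ball 0 \<epsilon> - {0 :: complex}"
      using \<epsilon> by (intro eventually_at_in_open) auto
    then show "\<forall>\<^sub>F t in at 0. snd (?D t) - slope A b (fst (?D t))
        = \<gamma> t + slope A (\<beta> t) (fst (\<phi> t (y, u y)))"
    proof eventually_elim
      case (elim t)
      have "snd (\<phi> t (y, u y)) = c1 t + slope A (b1 t) (fst (\<phi> t (y, u y)))" using cb y elim by blast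
      then show ?case
        using \<phi>0[OF y]
        by (simp add: pt_scale_def u \<gamma>_def \<beta>_def slope_scale_right slope_scale_left slope.diff_left
            slope.diff_right vec_eq_iff algebra_simps)
    qed
  qed
  obtain \<delta> where \<delta>: "\<delta> > 0" "ball x \<delta> \<subseteq> W" using W openE by blast
  define s :: complex where "s = of_real (\<delta> / 2)"
  have s: "s \<noteq> 0" "norm s < \<delta>" using \<delta> by (auto simp: s_def)
  have xs: "x + axis i s \<in> W" for i
    using s by (intro subsetD[OF \<delta>(2)]) (simp add: dist_norm norm_axis)
  \<comment> \<open>Subtracting \<open>N\<close> at \<open>x\<close> from \<open>N\<close> at
    \<open>x + axis i s\<close> cancels \<open>\<gamma> t\<close>. In component \<open>one\<close>,
    what remains is the pairing of \<open>\<beta> t\<close> with the displacement of the two moved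
    points, which tends to \<open>axis i s\<close>.\<close>
  have "Bfun \<beta> (at 0)"
  proof (rule Bfun_of_almost_identity[OF s(1)])
    let ?M = "\<lambda>i t. fst (\<phi> t (x + axis i s, u (x + axis i s))) - fst (\<phi> t (x, u x))"
    show "(?M i \<longlongrightarrow> axis i s) (at 0)" for i
      using tendsto_diff[OF q[OF xs[of i]] q[OF W(2)]] by simp
    show "((\<lambda>t. \<Sum>j\<in>UNIV. \<beta> t $ j * ?M i t $ j) \<longlongrightarrow> ?w (x + axis i s) $ one - ?w x $ one) (at 0)" for i
    proof -
      have eq: "(\<Sum>j\<in>UNIV. \<beta> t $ j * ?M i t $ j)
          = (\<gamma> t + slope A (\<beta> t) (fst (\<phi> t (x + axis i s, u (x + axis i s))))) $ one
            - (\<gamma> t + slope A (\<beta> t) (fst (\<phi> t (x, u x)))) $ one" for t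
        by (simp add: slope_one[of A one, OF one] algebra_simps sum_subtractf)
      show ?thesis
        unfolding eq by (intro tendsto_diff tendsto_vec_nth N xs W(2))
    qed
  qed
  \<comment> \<open>Bounded slope times vanishing displacement: the moved base point may be replaced
    by \<open>y\<close>.\<close>
  then have lim0: "((\<lambda>t. slope A (\<beta> t) (fst (\<phi> t (y, u y)) - y)) \<longlongrightarrow> 0) (at 0)" if "y \<in> W" for y
    using slope.Bfun_prod_Zfun[of \<beta> "at 0" "\<lambda>t. fst (\<phi> t (y, u y)) - y"] q[OF that]
    by (simp add: tendsto_Zfun_iff)
  have lim: "((\<lambda>t. \<gamma> t + slope A (\<beta> t) y) \<longlongrightarrow> ?w y) (at 0)" if "y \<in> W" for y
    using tendsto_diff[OF N[OF that] lim0[OF that]] by (simp add: slope.diff_right)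
  \<comment> \<open>Keeps \<open>t *s v\<close> shorter than \<delta>; the summand 1 covers v =
    0.\<close>
  define r where "r = \<delta> / (norm v + 1)"
  have r: "r > 0" using \<delta> by (simp add: r_def add_nonneg_pos)
  have in_W: "x + t *s v \<in> W" if "norm t < r" for t
  proof -
    have "norm t * norm v \<le> norm t * (norm v + 1)" by (simp add: mult_left_mono)
    also have "\<dots> < \<delta>" using that by (simp add: r_def pos_less_divide_eq add_nonneg_pos)
    finally show ?thesis by (intro subsetD[OF \<delta>(2)]) (simp add: dist_norm norm_vec_scale)
  qed
  have "\<exists>d. \<forall>s. norm s < r \<longrightarrow> ?w (x + s *s v) = ?w (x + 0 *s v) + s *s d"
  proof (rule affine_limit[OF _ r])
    fix s :: complex assume "norm s < r"
    from lim[OF in_W[OF this]]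
    show "((\<lambda>t. (\<gamma> t + slope A (\<beta> t) x) + s *s slope A (\<beta> t) v) \<longlongrightarrow> ?w (x + s *s v)) (at 0)"
      by (simp add: slope.add_right slope_scale_right add.assoc)
  qed
  then show ?thesis using in_W r by (intro exI[of _ r]) auto
qed

text \<open>Local constancy on a connected set is used twice: first for the local slope, then for
  \<open>g\<close> minus the linear part with the common slope.\<close>

lemma locally_affine_imp_affine:
  fixes g :: "complex \<Rightarrow> complex ^ 'm::finite"
  assumes S: "open S" "convex S" "0 \<in> S"
    and loc: "\<And>\<alpha>. \<alpha> \<in> S \<Longrightarrow> \<exists>r>0. \<exists>d. \<forall>s. norm s < r \<longrightarrow> g (\<alpha> + s) = g \<alpha> + s *s d"
  shows "\<exists>d. \<forall>\<alpha>\<in>S. g \<alpha> = g 0 + \<alpha> *s d"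
proof -
  have "\<forall>\<alpha>\<in>S. \<exists>d. \<exists>r>0. \<forall>s. norm s < r \<longrightarrow> g (\<alpha> + s) = g \<alpha> + s *s d" using loc by blast
  from bchoice[OF this] obtain d where d:
    "\<forall>\<alpha>\<in>S. \<exists>r>0. \<forall>s. norm s < r \<longrightarrow> g (\<alpha> + s) = g \<alpha> + s *s d \<alpha>" ..
  have "d constant_on S"
  proof (rule locally_constant_imp_constant[OF convex_connected[OF S(2)]])
    fix \<alpha> assume \<alpha>: "\<alpha> \<in> S"
    then obtain r where r: "r > 0" "\<And>s. norm s < r \<Longrightarrow> g (\<alpha> + s) = g \<alpha> + s *s d \<alpha>" using d by blast
    have "d \<alpha>' = d \<alpha>" if \<alpha>': "\<alpha>' \<in> S \<inter> ball \<alpha> r" for \<alpha>'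
    proof -
      obtain r' where r': "r' > 0" "\<And>s. norm s < r' \<Longrightarrow> g (\<alpha>' + s) = g \<alpha>' + s *s d \<alpha>'"
        using d \<alpha>' by blast
      define \<sigma> where "\<sigma> = \<alpha>' - \<alpha>"
      have \<sigma>: "norm \<sigma> < r" using \<alpha>' by (simp add: \<sigma>_def dist_norm norm_minus_commute)
      \<comment> \<open>A nonzero increment so small that both the expansion at
        \<open>\<alpha>'\<close> and the one at \<open>\<alpha>\<close> apply to
        \<open>\<alpha>' + s\<close>; comparing them identifies the two slopes.\<close>
      define s :: complex where "s = of_real (min r' (r - norm \<sigma>) / 2)"
      have s: "s \<noteq> 0" "norm s < r'" "norm s < r - norm \<sigma>" using r' \<sigma> by (auto simp: s_def)
      then have "norm (\<sigma> + s) < r" using norm_triangle_ineq[of \<sigma> s] by simp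
      from r(2)[OF this] have "g (\<alpha>' + s) = g \<alpha> + (\<sigma> + s) *s d \<alpha>" by (simp add: \<sigma>_def)
      moreover have "g \<alpha>' = g \<alpha> + \<sigma> *s d \<alpha>" using r(2)[OF \<sigma>] by (simp add: \<sigma>_def)
      ultimately have "s *s d \<alpha>' = s *s d \<alpha>"
        using r'(2)[OF s(2)] by (simp add: vector_sadd_rdistrib)
      then show ?thesis using s(1) by (simp add: vector_mul_lcancel)
    qed
    moreover have "openin (top_of_set S) (S \<inter> ball \<alpha> r)" by (simp add: openin_open_Int)
    moreover have "\<alpha> \<in> S \<inter> ball \<alpha> r" using \<alpha> r(1) by simp
    ultimately show "\<exists>T. openin (top_of_set S) T \<and> \<alpha> \<in> T \<and> (\<forall>x\<in>T. d x = d \<alpha>)" by blast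
  qed
  then obtain d0 where d0: "\<And>\<alpha>. \<alpha> \<in> S \<Longrightarrow> d \<alpha> = d0" unfolding constant_on_def by blast
  have "(\<lambda>\<alpha>. g \<alpha> - \<alpha> *s d0) constant_on S"
  proof (rule locally_constant_imp_constant[OF convex_connected[OF S(2)]])
    fix \<alpha> assume \<alpha>: "\<alpha> \<in> S"
    then obtain r where r: "r > 0" "\<And>s. norm s < r \<Longrightarrow> g (\<alpha> + s) = g \<alpha> + s *s d0" using d d0 by force
    have "g \<alpha>' - \<alpha>' *s d0 = g \<alpha> - \<alpha> *s d0" if \<alpha>': "\<alpha>' \<in> S \<inter> ball \<alpha> r" for \<alpha>'
      using r(2)[of "\<alpha>' - \<alpha>"] \<alpha>'
      by (simp add: dist_norm norm_minus_commute vector_ssub_ldistrib vec.scale_left_diff_distrib)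
    moreover have "openin (top_of_set S) (S \<inter> ball \<alpha> r)" by (simp add: openin_open_Int)
    moreover have "\<alpha> \<in> S \<inter> ball \<alpha> r" using \<alpha> r(1) by simp
    ultimately show "\<exists>T. openin (top_of_set S) T \<and> \<alpha> \<in> T \<and> (\<forall>x\<in>T. g x - x *s d0 = g \<alpha> - \<alpha> *s d0)"
      by blast
  qed
  then obtain e where "\<And>\<alpha>. \<alpha> \<in> S \<Longrightarrow> g \<alpha> - \<alpha> *s d0 = e" unfolding constant_on_def by blast
  then have "g \<alpha> = g 0 + \<alpha> *s d0" if "\<alpha> \<in> S" for \<alpha>
    using that S(3) by (metis add.commute diff_add_cancel diff_zero vec.scale_zero_left)
  then show ?thesis by blast
qed

subsection \<open>Vector fields that are quadratic along the directions of a basis\<close>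

text \<open>The coefficients may vary with \<open>z\<close> in any manner, so this is quadratic
  behaviour in one variable at a time. One triple serves all t for which the point lies in
  \<open>R\<close>.\<close>

definition quadratic_along ::
    "('n::finite, 'm::finite) pt \<Rightarrow> ('n, 'm) vfield \<Rightarrow> ('n, 'm) pt set \<Rightarrow> bool"
  where "quadratic_along e X R \<longleftrightarrow>
    (\<forall>z\<in>R. \<exists>a b c. \<forall>t. z + pt_scale t e \<in> R \<longrightarrow>
      X (z + pt_scale t e) = a + pt_scale t b + pt_scale (t\<^sup>2) c)"

lemma sum_fun_apply: "(\<Sum>i\<in>I. f i) x = (\<Sum>i\<in>I. f i x)"
  by (induction I rule: infinite_finite_induct) auto

text \<open>Lagrange interpolation at the nodes 0, h, 2h. It replaces the coefficients, whose
  dependence on the other coordinates is unknown, by values of the function.\<close>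

lemma quadratic_interpolation:
  assumes f: "\<And>t. t \<in> {0, h, 2 * h, s} \<Longrightarrow> f t = a + pt_scale t b + pt_scale (t\<^sup>2) c" and "h \<noteq> 0"
  shows "f s = pt_scale ((s - h) * (s - 2 * h) / (2 * h\<^sup>2)) (f 0)
    + pt_scale (- s * (s - 2 * h) / h\<^sup>2) (f h)
    + pt_scale (s * (s - h) / (2 * h\<^sup>2)) (f (2 * h))"
proof -
  have e: "f s = a + pt_scale s b + pt_scale (s\<^sup>2) c" "f 0 = a"
    "f h = a + pt_scale h b + pt_scale (h\<^sup>2) c"
    "f (2 * h) = a + pt_scale (2 * h) b + pt_scale ((2 * h)\<^sup>2) c"
    using f by auto
  have key: "x + s * y + s\<^sup>2 * z = ((s - h) * (s - 2 * h) / (2 * h\<^sup>2)) * x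
      + (- s * (s - 2 * h) / h\<^sup>2) * (x + h * y + h\<^sup>2 * z)
      + (s * (s - h) / (2 * h\<^sup>2)) * (x + (2 * h) * y + (2 * h)\<^sup>2 * z)" for x y z
    using \<open>h \<noteq> 0\<close> by (simp add: divide_simps) (simp add: algebra_simps power2_eq_square)
  then show ?thesis
    unfolding e prod_eq_iff vec_eq_iff fst_add snd_add vector_add_component pt_scale_def fst_conv snd_conv
      vector_smult_component
    by (intro conjI allI) (rule key)+
qed

section \<open>Coordinates, polydiscs and monomials of a basis\<close>

locale pt_basis =
  fixes B :: "('n::finite, 'm::finite) pt set"
  assumes finite_basis: "finite B" and independent_basis: "pt.independent B"
    and span_basis: "pt.span B = UNIV"
begin

abbreviation coord :: "('n, 'm) pt \<Rightarrow> ('n, 'm) pt \<Rightarrow> complex"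
  where "coord e z \<equiv> pt.representation B z e"

lemma coord_add: "coord e (y + z) = coord e y + coord e z"
  by (simp add: pt.representation_add independent_basis span_basis)

lemma coord_diff: "coord e (y - z) = coord e y - coord e z"
  by (simp add: pt.representation_diff independent_basis span_basis)

lemma coord_scale: "coord e (pt_scale c z) = c * coord e z"
  by (simp add: pt.representation_scale independent_basis span_basis)

lemma coord_basis: "e' \<in> B \<Longrightarrow> coord e e' = (if e = e' then 1 else 0)"
  by (simp add: pt.representation_basis independent_basis)

lemmas coord_simps = coord_add coord_diff coord_scale coord_basis

lemma coord_expansion: "(\<Sum>e\<in>B. pt_scale (coord e z) e) = z"
  using pt.sum_representation_eq[OF independent_basis _ finite_basis subset_refl] span_basis by auto

lemma linear_coord: "linear (\<lambda>z. coord e z)"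
  by (rule linearI) (simp_all add: coord_simps scaleR_eq_pt_scale scaleR_conv_of_real)

lemma continuous_on_coord: "continuous_on S (\<lambda>z. coord e z)"
  using linear_coord by (simp add: linear_continuous_on linear_conv_bounded_linear)

text \<open>The polydisc is taken in the coordinates of \<open>B\<close>, so a single basis
  coordinate can be changed within its disc without regard to the others.\<close>

definition polydisc :: "('n, 'm) pt \<Rightarrow> real \<Rightarrow> ('n, 'm) pt set"
  where "polydisc q r = {z. \<forall>e\<in>B. norm (coord e (z - q)) < r}"

lemma open_polydisc: "open (polydisc q r)"
proof -
  have "polydisc q r = (\<Inter>e\<in>B. {z. norm (coord e (z - q)) < r})"
    by (auto simp: polydisc_def)
  moreover have "open {z. norm (coord e (z - q)) < r}" for e
    unfolding coord_diff by (intro open_Collect_less continuous_intros continuous_on_coord)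
  ultimately show ?thesis using finite_basis by auto
qed

lemma polydisc_center: "r > 0 \<Longrightarrow> q \<in> polydisc q r"
  by (simp add: polydisc_def pt.representation_zero)

lemma convex_polydisc: "convex (polydisc q r)"
proof -
  have "polydisc q r = (\<Inter>e\<in>B. (\<lambda>z. coord e z) -` ball (coord e q) r)"
    by (auto simp: polydisc_def coord_diff dist_norm norm_minus_commute)
  moreover have "convex (\<Inter>e\<in>B. (\<lambda>z. coord e z) -` ball (coord e q) r)"
    by (intro convex_INT convex_linear_vimage linear_coord convex_ball)
  ultimately show ?thesis by simp
qed

lemma polydisc_in_open:
  assumes "open U" "q \<in> U"
  obtains r where "r > 0" "polydisc q r \<subseteq> U"
proof -
  obtain d where d: "d > 0" "ball q d \<subseteq> U" using assms openE by blast
  \<comment> \<open>The summand 1 makes \<open>M\<close> positive and leaves room for the strict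
    inequality at the end.\<close>
  define M where "M = (\<Sum>e\<in>B. norm e) + 1"
  have M: "M > 0" by (simp add: M_def add_nonneg_pos sum_nonneg)
  have "polydisc q (d / M) \<subseteq> ball q d"
  proof
    fix z assume z: "z \<in> polydisc q (d / M)"
    have "norm (z - q) = norm (\<Sum>e\<in>B. pt_scale (coord e (z - q)) e)" by (simp add: coord_expansion)
    also have "\<dots> \<le> (\<Sum>e\<in>B. norm (pt_scale (coord e (z - q)) e))" by (rule norm_sum)
    also have "\<dots> \<le> (\<Sum>e\<in>B. d / M * norm e)"
      using z by (intro sum_mono) (simp add: norm_pt_scale polydisc_def mult_right_mono less_imp_le del: times_divide_eq_left)
    also have "\<dots> = d / M * (M - 1)" by (simp add: M_def sum_distrib_left)
    also have "\<dots> < d" using d M by (simp add: field_simps)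
    finally show "z \<in> ball q d" by (simp add: dist_norm norm_minus_commute)
  qed
  then show thesis using that[of "d / M"] d M by auto
qed

lemma polydisc_line:
  assumes "z \<in> polydisc q r" "e \<in> B"
  shows "z + pt_scale t e \<in> polydisc q r \<longleftrightarrow> norm (coord e (z - q) + t) < r"
proof -
  have "coord e' (z + pt_scale t e - q) = coord e' (z - q) + (if e' = e then t else 0)" for e'
    using assms by (simp add: coord_simps)
  then show ?thesis using assms by (auto simp: polydisc_def)
qed

text \<open>Products of coordinate powers with exponents 0, 1, 2 times a constant basis vector. The
  recursion adds one variable at a time, matching the interpolation argument.\<close>

fun monomials :: "('n, 'm) pt list \<Rightarrow> ('n, 'm) vfield set"
  where "monomials [] = (\<lambda>b _. b) ` B"
  | "monomials (e # es) = (\<lambda>(i, Y) z. pt_scale (coord e z ^ i) (Y z)) ` ({..2} \<times> monomials es)"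

lemma finite_monomials: "finite (monomials es)"
  by (induction es) (auto simp: finite_basis)

lemma const_in_span_monomials: "(\<lambda>_. c) \<in> vf.span (monomials [])"
proof -
  have "(\<lambda>_. c) = (\<Sum>e\<in>B. vf_scale (coord e c) (\<lambda>_. e))"
    by (rule ext) (simp only: sum_fun_apply vf_scale_def coord_expansion)
  also have "\<dots> \<in> vf.span (monomials [])"
    by (intro vf.span_sum vf.span_scale vf.span_base) simp
  finally show ?thesis .
qed

lemma mult_coord_in_span_monomials:
  assumes "Y \<in> vf.span (monomials es)" "i \<le> 2"
  shows "(\<lambda>z. pt_scale (coord e z ^ i) (Y z)) \<in> vf.span (monomials (e # es))"
  using assms(1)
proof (induction rule: vf.span_induct)
  case base
  show ?case
  proof (rule vf.subspaceI)
    show "0 \<in> {Y. (\<lambda>z. pt_scale (coord e z ^ i) (Y z)) \<in> vf.span (monomials (e # es))}"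
      using vf.span_zero by (simp add: zero_fun_def)
    fix x y c
    assume x: "x \<in> {Y. (\<lambda>z. pt_scale (coord e z ^ i) (Y z)) \<in> vf.span (monomials (e # es))}"
    have "(\<lambda>z. pt_scale (coord e z ^ i) (vf_scale c x z)) = vf_scale c (\<lambda>z. pt_scale (coord e z ^ i) (x z))"
      by (simp add: fun_eq_iff vf_scale_def mult.commute)
    then show "vf_scale c x \<in> {Y. (\<lambda>z. pt_scale (coord e z ^ i) (Y z)) \<in> vf.span (monomials (e # es))}"
      using x vf.span_scale by auto
    assume y: "y \<in> {Y. (\<lambda>z. pt_scale (coord e z ^ i) (Y z)) \<in> vf.span (monomials (e # es))}"
    have "(\<lambda>z. pt_scale (coord e z ^ i) ((x + y) z))
        = (\<lambda>z. pt_scale (coord e z ^ i) (x z)) + (\<lambda>z. pt_scale (coord e z ^ i) (y z))"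
      by (simp add: fun_eq_iff pt.scale_right_distrib)
    then show "x + y \<in> {Y. (\<lambda>z. pt_scale (coord e z ^ i) (Y z)) \<in> vf.span (monomials (e # es))}"
      using x y vf.span_add by auto
  qed
next
  case (step Y)
  then show ?case using assms(2) by (intro vf.span_base) auto
qed

lemma quadratic_mult_coord_in_span_monomials:
  assumes "Y \<in> vf.span (monomials es)"
  shows "(\<lambda>z. pt_scale (a + b * coord e z + c * (coord e z)\<^sup>2) (Y z)) \<in> vf.span (monomials (e # es))"
proof -
  have "(\<lambda>z. pt_scale (a + b * coord e z + c * (coord e z)\<^sup>2) (Y z))
      = vf_scale a (\<lambda>z. pt_scale (coord e z ^ 0) (Y z)) + vf_scale b (\<lambda>z. pt_scale (coord e z ^ 1) (Y z))
        + vf_scale c (\<lambda>z. pt_scale (coord e z ^ 2) (Y z))"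
    by (simp add: fun_eq_iff vf_scale_def pt.scale_left_distrib)
  also have "\<dots> \<in> vf.span (monomials (e # es))"
    by (intro vf.span_add vf.span_scale mult_coord_in_span_monomials assms) auto
  finally show ?thesis .
qed

lemma constant_on_polydisc:
  assumes const: "\<And>e z t. e \<in> B \<Longrightarrow> z \<in> polydisc q r \<Longrightarrow> z + pt_scale t e \<in> polydisc q r \<Longrightarrow>
      X (z + pt_scale t e) = X z"
    and z: "z \<in> polydisc q r"
  shows "X z = X q"
proof -
  \<comment> \<open>For empty \<open>B\<close> the polydisc is the whole space whatever
    \<open>r\<close> is; otherwise a point in it forces \<open>r\<close> to be positive.\<close>
  have "r > 0 \<or> B = {}"
  proof (cases "B = {}")
    case False
    then obtain e where "e \<in> B" by blast
    then have "norm (coord e (z - q)) < r" using z by (simp add: polydisc_def)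
    then show ?thesis using le_less_trans[OF norm_ge_zero] by blast
  qed simp
  then have q: "q \<in> polydisc q r"
    using polydisc_center by (auto simp: polydisc_def)
  have "q + (\<Sum>e\<in>T. pt_scale (coord e (z - q)) e) \<in> polydisc q r \<and>
      X (q + (\<Sum>e\<in>T. pt_scale (coord e (z - q)) e)) = X q" if "T \<subseteq> B" for T
    using finite_subset[OF that finite_basis] that
  proof (induction T rule: finite_induct)
    case empty
    then show ?case using q by simp
  next
    case (insert e T)
    let ?s = "\<Sum>e\<in>T. pt_scale (coord e (z - q)) e"
    have IH: "q + ?s \<in> polydisc q r" "X (q + ?s) = X q" using insert by auto
    have "coord e ?s = (\<Sum>e'\<in>T. coord e' (z - q) * coord e e')"
      by (subst pt.representation_sum) (auto simp: independent_basis span_basis coord_scale)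
    also have "\<dots> = 0"
    proof (intro sum.neutral ballI)
      fix e' assume "e' \<in> T"
      then have "e' \<in> B" "e \<noteq> e'" using insert by auto
      then show "coord e' (z - q) * coord e e' = 0" by (simp add: coord_basis)
    qed
    finally have 0: "coord e ?s = 0" .
    have eq: "q + (\<Sum>e\<in>insert e T. pt_scale (coord e (z - q)) e) = q + ?s + pt_scale (coord e (z - q)) e"
      using insert by (simp add: algebra_simps)
    have "q + ?s + pt_scale (coord e (z - q)) e \<in> polydisc q r"
      using IH insert z by (subst polydisc_line) (auto simp: 0 polydisc_def)
    then show ?case
      unfolding eq using const[OF _ IH(1)] IH insert by auto
  qed
  from this[OF subset_refl] show ?thesis by (simp add: coord_expansion)
qed

text \<open>Induction on the variables that X really depends on. Freezing the coordinate of the head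
  \<open>e\<close> at three nodes gives three fields that are constant along \<open>e\<close>, to
  which the induction hypothesis applies; X is recovered from them by interpolation in that
  coordinate.\<close>

lemma quadratic_imp_in_span_monomials:
  assumes "r > 0" "distinct es" "set es \<subseteq> B"
    and "\<And>e. e \<in> set es \<Longrightarrow> quadratic_along e X (polydisc q r)"
    and "\<And>e z t. e \<in> B - set es \<Longrightarrow> z \<in> polydisc q r \<Longrightarrow> z + pt_scale t e \<in> polydisc q r \<Longrightarrow>
      X (z + pt_scale t e) = X z"
  shows "\<exists>Y\<in>vf.span (monomials es). \<forall>z\<in>polydisc q r. X z = Y z"
  using assms(2-)
proof (induction es arbitrary: X)
  case Nil
  then have "X z = X q" if "z \<in> polydisc q r" for z
    using constant_on_polydisc[OF _ that, of X] by simp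
  then show ?case using const_in_span_monomials[of "X q"] by (intro bexI[of _ "\<lambda>_. X q"]) auto
next
  case (Cons e es)
  \<comment> \<open>With a third of the radius, all three nodes 0, h, 2h lie in the disc.\<close>
  define h :: complex where "h = of_real (r / 3)"
  have h: "h \<noteq> 0" "norm h < r" "norm (2 * h) < r" using \<open>r > 0\<close> by (auto simp: h_def norm_mult)
  \<comment> \<open>\<open>w j\<close> resets the e-coordinate to that of \<open>q\<close> plus
    \<open>j * h\<close> and leaves the other coordinates alone.\<close>
  define w where "w j z = z + pt_scale (j * h - coord e (z - q)) e" for j :: complex and z
  have e: "e \<in> B" "e \<notin> set es" using Cons.prems by auto
  have w_shift: "w j (z + pt_scale t e') = w j z + pt_scale t e'" if "e' \<in> B" "e' \<noteq> e" for j z t e'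
    using that e by (simp add: w_def coord_simps)
  have w_shift_e: "w j (z + pt_scale t e) = w j z" for j z t
    using e by (simp add: w_def coord_simps pt.scale_left_diff_distrib pt.scale_left_distrib)
  have w_in: "w j z \<in> polydisc q r" if "z \<in> polydisc q r" "j \<in> {0,1,2}" for j z
    using that e h \<open>r > 0\<close> unfolding w_def by (subst polydisc_line) auto
  have w_line: "w j z + pt_scale t e' \<in> polydisc q r"
    if "z \<in> polydisc q r" "j \<in> {0,1,2}" "z + pt_scale t e' \<in> polydisc q r" "e' \<in> B" "e' \<noteq> e" for j z t e'
    using w_in[OF that(3,2)] w_shift[OF that(4,5)] by simp
  have "\<exists>Y\<in>vf.span (monomials es). \<forall>z\<in>polydisc q r. X (w j z) = Y z" if j: "j \<in> {0,1,2}" for j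
  proof (rule Cons.IH)
    show "distinct es" "set es \<subseteq> B" using Cons.prems by auto
    show "quadratic_along e' (\<lambda>z. X (w j z)) (polydisc q r)" if e': "e' \<in> set es" for e'
      unfolding quadratic_along_def
    proof
      fix z assume z: "z \<in> polydisc q r"
      have "quadratic_along e' X (polydisc q r)" using Cons.prems e' by auto
      then obtain a b c where
        "\<forall>t. w j z + pt_scale t e' \<in> polydisc q r \<longrightarrow>
          X (w j z + pt_scale t e') = a + pt_scale t b + pt_scale (t\<^sup>2) c"
        using w_in[OF z j] unfolding quadratic_along_def by blast
      moreover have "e' \<in> B" "e' \<noteq> e" using e e' Cons.prems by auto
      ultimately show "\<exists>a b c. \<forall>t. z + pt_scale t e' \<in> polydisc q r \<longrightarrow>
          X (w j (z + pt_scale t e')) = a + pt_scale t b + pt_scale (t\<^sup>2) c"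
        using w_line[OF z j] w_shift by metis
    qed
    show "X (w j (z + pt_scale t e')) = X (w j z)"
      if "e' \<in> B - set es" "z \<in> polydisc q r" "z + pt_scale t e' \<in> polydisc q r" for e' z t
      using that w_shift_e w_shift w_line[OF that(2) j that(3)] w_in[OF that(2) j] Cons.prems(4)[of e']
      by (cases "e' = e") auto
  qed
  then obtain Y where Y: "\<And>j. j \<in> {0,1,2} \<Longrightarrow> Y j \<in> vf.span (monomials es)"
    "\<And>j z. j \<in> {0,1,2} \<Longrightarrow> z \<in> polydisc q r \<Longrightarrow> X (w j z) = Y j z"
    by metis
  \<comment> \<open>Monomials use uncentred coordinates, so the Lagrange polynomials below have the
    nodes c, c + h, c + 2h; \<open>l\<close> expands them in powers of s.\<close>
  define c where "c = coord e q"
  let ?l0 = "\<lambda>s. (s - c - h) * (s - c - 2 * h) / (2 * h\<^sup>2)"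
  let ?l1 = "\<lambda>s. - (s - c) * (s - c - 2 * h) / h\<^sup>2"
  let ?l2 = "\<lambda>s. (s - c) * (s - c - h) / (2 * h\<^sup>2)"
  have l: "?l0 s = (c + h) * (c + 2 * h) / (2 * h\<^sup>2) + (- (2 * c + 3 * h) / (2 * h\<^sup>2)) * s + 1 / (2 * h\<^sup>2) * s\<^sup>2"
    "?l1 s = - c * (c + 2 * h) / h\<^sup>2 + (2 * c + 2 * h) / h\<^sup>2 * s + (- 1 / h\<^sup>2) * s\<^sup>2"
    "?l2 s = c * (c + h) / (2 * h\<^sup>2) + (- (2 * c + h) / (2 * h\<^sup>2)) * s + 1 / (2 * h\<^sup>2) * s\<^sup>2" for s
    using h(1) by (simp_all add: divide_simps) (simp_all add: algebra_simps power2_eq_square)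
  define Z where "Z = (\<lambda>z. pt_scale (?l0 (coord e z)) (Y 0 z)) + (\<lambda>z. pt_scale (?l1 (coord e z)) (Y 1 z))
    + (\<lambda>z. pt_scale (?l2 (coord e z)) (Y 2 z))"
  have "Z \<in> vf.span (monomials (e # es))"
    unfolding Z_def l by (intro vf.span_add quadratic_mult_coord_in_span_monomials Y) auto
  moreover have "X z = Z z" if z: "z \<in> polydisc q r" for z
  proof -
    have "quadratic_along e X (polydisc q r)" using Cons.prems by simp
    then obtain a b d where abd:
      "\<forall>t. w 0 z + pt_scale t e \<in> polydisc q r \<longrightarrow>
          X (w 0 z + pt_scale t e) = a + pt_scale t b + pt_scale (t\<^sup>2) d"
      using w_in[OF z, of 0] unfolding quadratic_along_def by blast
    have w: "w j z = w 0 z + pt_scale (j * h) e" for j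
      by (simp add: w_def pt.scale_left_diff_distrib algebra_simps)
    have z': "w 0 z + pt_scale (coord e z - c) e = z"
      by (simp add: w_def c_def coord_diff pt.scale_left_diff_distrib algebra_simps)
    have "w 0 z + pt_scale t e \<in> polydisc q r" if "t \<in> {0, h, 2 * h, coord e z - c}" for t
      using that z z' w_in[OF z, of 0] w_in[OF z, of 1] w_in[OF z, of 2] w[of 0] w[of 1] w[of 2] by auto
    then have "X (w 0 z + pt_scale t e) = a + pt_scale t b + pt_scale (t\<^sup>2) d"
      if "t \<in> {0, h, 2 * h, coord e z - c}" for t using abd that by blast
    from quadratic_interpolation[of h "coord e z - c" "\<lambda>t. X (w 0 z + pt_scale t e)", OF this h(1)]
    show ?thesis
      using w[of 1] w[of 2] Y(2)[of 0 z] Y(2)[of 1 z] Y(2)[of 2 z] z z' by (simp add: Z_def)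
  qed
  ultimately show ?case by blast
qed

section \<open>Identity theorem for the span of the monomials, and gluing\<close>

lemma subspace_constant_along: "vf.subspace {Y. \<forall>z t. Y (z + pt_scale t e) = Y z}"
  by (rule vf.subspaceI) (auto simp: vf_scale_def)

lemma subspace_quadratic_along: "vf.subspace {Y. quadratic_along e Y R}"
proof (rule vf.subspaceI)
  show "0 \<in> {Y. quadratic_along e Y R}"
    unfolding quadratic_along_def mem_Collect_eq by (intro ballI exI[of _ 0]) simp
next
  fix X Y assume X: "X \<in> {Y. quadratic_along e Y R}" and Y: "Y \<in> {Y. quadratic_along e Y R}"
  show "X + Y \<in> {Y. quadratic_along e Y R}"
    unfolding quadratic_along_def mem_Collect_eq
  proof
    fix z assume "z \<in> R"
    then obtain a b c a' b' c' where
      "\<forall>t. z + pt_scale t e \<in> R \<longrightarrow> X (z + pt_scale t e) = a + pt_scale t b + pt_scale (t\<^sup>2) c"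
      "\<forall>t. z + pt_scale t e \<in> R \<longrightarrow> Y (z + pt_scale t e) = a' + pt_scale t b' + pt_scale (t\<^sup>2) c'"
      using X Y unfolding quadratic_along_def mem_Collect_eq by metis
    then show "\<exists>a b c. \<forall>t. z + pt_scale t e \<in> R \<longrightarrow>
        (X + Y) (z + pt_scale t e) = a + pt_scale t b + pt_scale (t\<^sup>2) c"
      by (intro exI[of _ "a + a'"] exI[of _ "b + b'"] exI[of _ "c + c'"])
        (simp add: pt.scale_right_distrib)
  qed
next
  fix s X assume X: "X \<in> {Y. quadratic_along e Y R}"
  show "vf_scale s X \<in> {Y. quadratic_along e Y R}"
    unfolding quadratic_along_def mem_Collect_eq
  proof
    fix z assume "z \<in> R"
    then obtain a b c where
      "\<forall>t. z + pt_scale t e \<in> R \<longrightarrow> X (z + pt_scale t e) = a + pt_scale t b + pt_scale (t\<^sup>2) c"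
      using X unfolding quadratic_along_def mem_Collect_eq by metis
    then show "\<exists>a b c. \<forall>t. z + pt_scale t e \<in> R \<longrightarrow>
        (vf_scale s X) (z + pt_scale t e) = a + pt_scale t b + pt_scale (t\<^sup>2) c"
      by (intro exI[of _ "pt_scale s a"] exI[of _ "pt_scale s b"] exI[of _ "pt_scale s c"])
        (simp add: pt.scale_right_distrib vf_scale_def mult.commute)
  qed
qed

lemma span_monomials_constant_along:
  assumes "set es \<subseteq> B" "e \<in> B - set es" "Y \<in> vf.span (monomials es)"
  shows "Y (z + pt_scale t e) = Y z"
proof -
  have "monomials es \<subseteq> {Y. \<forall>z t. Y (z + pt_scale t e) = Y z}"
    using assms(1,2) by (induction es) (auto simp: coord_simps)
  then show ?thesis
    using vf.span_minimal[OF _ subspace_constant_along] assms(3) by blast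
qed

text \<open>By distinctness each coordinate enters through one factor only. If \<open>e\<close> is
  the head, the remaining product is constant along \<open>e\<close>; otherwise the head factor
  is.\<close>

lemma span_monomials_quadratic_along:
  assumes "distinct es" "set es \<subseteq> B" "e \<in> set es" "Y \<in> vf.span (monomials es)"
  shows "quadratic_along e Y UNIV"
  using assms
proof (induction es arbitrary: Y)
  case (Cons e' es)
  have "quadratic_along e (\<lambda>z. pt_scale (coord e' z ^ i) (Y z)) UNIV"
    if i: "i \<le> 2" and Y: "Y \<in> monomials es" for i Y
    unfolding quadratic_along_def
  proof
    fix z
    show "\<exists>a b c. \<forall>t. z + pt_scale t e \<in> UNIV \<longrightarrow>
      pt_scale (coord e' (z + pt_scale t e) ^ i) (Y (z + pt_scale t e)) = a + pt_scale t b + pt_scale (t\<^sup>2) c"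
    proof (cases "e = e'")
      case True
      then have Yc: "Y (z + pt_scale t e) = Y z" for t
        using span_monomials_constant_along[of es e Y z t] Cons.prems vf.span_base[OF Y] by auto
      have "\<exists>a b c. \<forall>t. (s + t) ^ i = a + t * b + t\<^sup>2 * c" for s :: complex
      proof -
        consider "i = 0" | "i = 1" | "i = 2" using i by linarith
        then show ?thesis
        proof cases
          case 1 then show ?thesis by (intro exI[of _ 1] exI[of _ 0]) simp
        next
          case 2 then show ?thesis by (intro exI[of _ s] exI[of _ 1] exI[of _ 0]) simp
        next
          case 3 then show ?thesis
            by (intro exI[of _ "s\<^sup>2"] exI[of _ "2 * s"] exI[of _ 1]) (simp add: power2_sum algebra_simps)
        qed
      qed
      then obtain a b c where abc: "\<And>t. (coord e' z + t) ^ i = a + t * b + t\<^sup>2 * c" by metis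
      have "coord e' (z + pt_scale t e) = coord e' z + t" for t
        using True Cons.prems by (simp add: coord_simps)
      then show ?thesis
        by (intro exI[of _ "pt_scale a (Y z)"] exI[of _ "pt_scale b (Y z)"] exI[of _ "pt_scale c (Y z)"])
          (simp add: Yc abc pt.scale_left_distrib)
    next
      case False
      then have c: "coord e' (z + pt_scale t e) = coord e' z" for t
        using Cons.prems by (auto simp: coord_simps)
      have "quadratic_along e Y UNIV"
        using Cons.IH[of Y] Cons.prems Y False vf.span_base by auto
      then obtain a b d where "\<forall>t. Y (z + pt_scale t e) = a + pt_scale t b + pt_scale (t\<^sup>2) d"
        unfolding quadratic_along_def by blast
      then show ?thesis
        by (intro exI[of _ "pt_scale (coord e' z ^ i) a"] exI[of _ "pt_scale (coord e' z ^ i) b"]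
            exI[of _ "pt_scale (coord e' z ^ i) d"]) (simp add: c pt.scale_right_distrib mult.commute)
    qed
  qed
  then have "monomials (e' # es) \<subseteq> {Y. quadratic_along e Y UNIV}" by auto
  then show ?case
    using vf.span_minimal[OF _ subspace_quadratic_along] Cons.prems(4) by blast
qed simp

text \<open>The coordinates are released from the polydisc one by one: a quadratic function of one
  variable that vanishes at 0, h, 2h vanishes on the whole line. \<open>T\<close> collects the
  released coordinates.\<close>

lemma quadratic_eq_0:
  assumes quad: "\<And>e. e \<in> B \<Longrightarrow> quadratic_along e Y UNIV"
    and "r > 0" and zero: "\<And>z. z \<in> polydisc q r \<Longrightarrow> Y z = 0"
  shows "Y z = 0"
proof -
  have "Y z = 0" if "T \<subseteq> B" "\<And>e. e \<in> B - T \<Longrightarrow> norm (coord e (z - q)) < r" for T z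
    using finite_subset[OF that(1) finite_basis] that
  proof (induction T arbitrary: z rule: finite_induct)
    case empty
    then show ?case using zero by (auto simp: polydisc_def)
  next
    case (insert e T)
    define h :: complex where "h = of_real (r / 3)"
    have h: "h \<noteq> 0" "norm h < r" "norm (2 * h) < r" using \<open>r > 0\<close> by (auto simp: h_def norm_mult)
    define w where "w = z - pt_scale (coord e (z - q)) e"
    have e: "e \<in> B" using insert by auto
    have cw: "coord e' (w + pt_scale t e - q) = (if e' = e then t else coord e' (z - q))" for e' t
      using e by (simp add: w_def coord_simps)
    have 0: "Y (w + pt_scale t e) = 0" if "norm t < r" for t
      using insert that cw by (intro insert.IH) auto
    obtain a b c where "\<And>t. Y (w + pt_scale t e) = a + pt_scale t b + pt_scale (t\<^sup>2) c"
      using quad[OF e] unfolding quadratic_along_def by (metis UNIV_I)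
    from quadratic_interpolation[of h "coord e (z - q)" "\<lambda>t. Y (w + pt_scale t e)", OF this h(1)]
    have "Y (w + pt_scale (coord e (z - q)) e) = 0"
      using 0[of 0] 0[of h] 0[of "2 * h"] h \<open>r > 0\<close> by simp
    then show ?case by (simp add: w_def)
  qed
  from this[of B] show ?thesis by simp
qed

text \<open>Each point has a representative in the span near it. Representatives at neighbouring
  points agree on a small polydisc, hence everywhere, so the choice is locally constant and
  therefore constant on the connected \<open>D\<close>.\<close>

lemma locally_quadratic_in_span:
  assumes es: "distinct es" "set es = B" and "connected D"
    and loc: "\<And>q. q \<in> D \<Longrightarrow> \<exists>r>0. polydisc q r \<subseteq> D \<and> (\<forall>e\<in>B. quadratic_along e X (polydisc q r))"
  shows "\<exists>Y\<in>vf.span (monomials es). \<forall>z\<in>D. X z = Y z"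
proof (cases "D = {}")
  case True
  then show ?thesis using vf.span_zero by blast
next
  case False
  have "\<exists>r Y. r > 0 \<and> polydisc q r \<subseteq> D \<and> Y \<in> vf.span (monomials es) \<and> (\<forall>z\<in>polydisc q r. X z = Y z)"
    if "q \<in> D" for q
  proof -
    obtain r where r: "r > 0" "polydisc q r \<subseteq> D" "\<forall>e\<in>B. quadratic_along e X (polydisc q r)"
      using loc \<open>q \<in> D\<close> by blast
    have "\<exists>Y\<in>vf.span (monomials es). \<forall>z\<in>polydisc q r. X z = Y z"
      by (rule quadratic_imp_in_span_monomials[OF r(1) es(1)]) (use r(3) es(2) in blast)+
    then show ?thesis using r by blast
  qed
  then have "\<forall>q\<in>D. \<exists>r Y. r > 0 \<and> polydisc q r \<subseteq> D \<and> Y \<in> vf.span (monomials es) \<and>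
      (\<forall>z\<in>polydisc q r. X z = Y z)" by blast
  from bchoice[OF this] obtain r where "\<forall>q\<in>D. \<exists>Y. r q > 0 \<and> polydisc q (r q) \<subseteq> D \<and>
      Y \<in> vf.span (monomials es) \<and> (\<forall>z\<in>polydisc q (r q). X z = Y z)" ..
  from bchoice[OF this] obtain Y where rY: "\<forall>q\<in>D. r q > 0 \<and> polydisc q (r q) \<subseteq> D \<and>
      Y q \<in> vf.span (monomials es) \<and> (\<forall>z\<in>polydisc q (r q). X z = Y q z)" ..
  then have r: "\<And>q. q \<in> D \<Longrightarrow> r q > 0" "\<And>q. q \<in> D \<Longrightarrow> polydisc q (r q) \<subseteq> D"
    and Y: "\<And>q. q \<in> D \<Longrightarrow> Y q \<in> vf.span (monomials es)"
    "\<And>q z. q \<in> D \<Longrightarrow> z \<in> polydisc q (r q) \<Longrightarrow> X z = Y q z" by simp_all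
  have eq: "Y q' = Y q" if q: "q \<in> D" and q': "q' \<in> polydisc q (r q)" for q q'
  proof (rule ext)
    have q'D: "q' \<in> D" using r(2)[OF q] q' by blast
    have "open (polydisc q (r q) \<inter> polydisc q' (r q'))" "q' \<in> polydisc q (r q) \<inter> polydisc q' (r q')"
      using q' polydisc_center[OF r(1)[OF q'D]] by (simp_all add: open_Int open_polydisc)
    then obtain s where s: "s > 0" "polydisc q' s \<subseteq> polydisc q (r q) \<inter> polydisc q' (r q')"
      by (rule polydisc_in_open)
    have "(Y q' - Y q) z = 0" for z
    proof (rule quadratic_eq_0[where Y = "Y q' - Y q" and q = q', OF _ s(1)])
      show "quadratic_along e (Y q' - Y q) UNIV" if "e \<in> B" for e
        using that es(2)
        by (intro span_monomials_quadratic_along[OF es(1)] vf.span_diff Y(1) q q'D) auto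
      show "(Y q' - Y q) w = 0" if "w \<in> polydisc q' s" for w
        using Y(2)[OF q, of w] Y(2)[OF q'D, of w] subsetD[OF s(2) that] by simp
    qed
    then show "Y q' z = Y q z" for z by (simp add: fun_diff_def)
  qed
  have "Y constant_on D"
  proof (rule locally_constant_imp_constant[OF \<open>connected D\<close>])
    fix q assume q: "q \<in> D"
    have "openin (top_of_set D) (polydisc q (r q))"
      using open_polydisc r(2)[OF q] by (rule open_subset[rotated])
    then show "\<exists>T. openin (top_of_set D) T \<and> q \<in> T \<and> (\<forall>x\<in>T. Y x = Y q)"
      using eq[OF q] polydisc_center[OF r(1)[OF q]] by blast
  qed
  then obtain Y0 where Y0: "\<And>q. q \<in> D \<Longrightarrow> Y q = Y0" unfolding constant_on_def by blast
  obtain p where p: "p \<in> D" using False by blast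
  have "X z = Y0 z" if "z \<in> D" for z
    using Y(2)[OF that polydisc_center[OF r(1)[OF that]]] Y0[OF that] by simp
  moreover have "Y0 \<in> vf.span (monomials es)" using Y(1)[OF p] unfolding Y0[OF p] .
  ultimately show ?thesis by blast
qed

end

text \<open>\<open>M\<close> need not lie in \<open>L\<close>, and \<open>L\<close> is not assumed
  to be a subspace. A maximal independent set among representatives of \<open>L\<close> in the span
  of \<open>M\<close> is finite; its preimages in \<open>L\<close> form \<open>B\<close>. The filter
  treats equality on a domain and equality of germs together.\<close>

lemma finite_dimensional_modulo_filter:
  assumes "finite M" and L: "\<And>X. X \<in> L \<Longrightarrow> \<exists>Y\<in>vf.span M. \<forall>\<^sub>F z in F. X z = Y z"
  shows "\<exists>B. finite B \<and> B \<subseteq> L \<and> (\<forall>X\<in>L. \<exists>Y\<in>vf.span B. \<forall>\<^sub>F z in F. X z = Y z)"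
proof -
  have "\<forall>X\<in>L. \<exists>Y. Y \<in> vf.span M \<and> (\<forall>\<^sub>F z in F. X z = Y z)" using L by blast
  from bchoice[OF this] obtain P where P: "\<And>X. X \<in> L \<Longrightarrow> P X \<in> vf.span M"
    "\<And>X. X \<in> L \<Longrightarrow> \<forall>\<^sub>F z in F. X z = P X z"
    by blast
  obtain C where C: "C \<subseteq> P ` L" "vf.independent C" "P ` L \<subseteq> vf.span C"
    using vf.maximal_independent_subset by blast
  have "finite C"
    using vf.independent_span_bound[OF \<open>finite M\<close> C(2)] C(1) P(1) by auto
  then obtain B where B: "B \<subseteq> L" "finite B" "C = P ` B"
    using finite_subset_image C(1) by metis
  let ?S = "{Z. \<exists>W\<in>vf.span B. \<forall>\<^sub>F z in F. Z z = W z}"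
  have "vf.subspace ?S"
  proof (rule vf.subspaceI)
    show "0 \<in> ?S" using vf.span_zero by (auto intro!: bexI[of _ 0])
    fix c Y Z assume Y: "Y \<in> ?S"
    then obtain V where V: "V \<in> vf.span B" "\<forall>\<^sub>F z in F. Y z = V z" by auto
    from V(2) have "\<forall>\<^sub>F z in F. vf_scale c Y z = vf_scale c V z"
      by (rule eventually_mono) (simp add: vf_scale_def)
    then show "vf_scale c Y \<in> ?S" using V vf.span_scale by blast
    assume "Z \<in> ?S"
    then obtain W where W: "W \<in> vf.span B" "\<forall>\<^sub>F z in F. Z z = W z" by auto
    from V(2) W(2) have "\<forall>\<^sub>F z in F. (Y + Z) z = (V + W) z" by eventually_elim simp
    then show "Y + Z \<in> ?S" using V W vf.span_add by blast
  qed
  moreover have "C \<subseteq> ?S"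
  proof
    fix Z assume "Z \<in> C"
    then obtain X where X: "X \<in> B" "Z = P X" using B by auto
    have "\<forall>\<^sub>F z in F. P X z = X z"
      using eventually_mono[OF P(2) sym] B(1) X by blast
    then show "Z \<in> ?S" using X vf.span_base by blast
  qed
  ultimately have span: "vf.span C \<subseteq> ?S" by (intro vf.span_minimal)
  have "\<exists>Y\<in>vf.span B. \<forall>\<^sub>F z in F. X z = Y z" if X: "X \<in> L" for X
  proof -
    obtain W where "W \<in> vf.span B" "\<forall>\<^sub>F z in F. P X z = W z" using span C(3) X by blast
    moreover from this(2) P(2)[OF X] have "\<forall>\<^sub>F z in F. X z = W z" by eventually_elim simp
    ultimately show ?thesis by blast
  qed
  then show ?thesis using B by blast
qed

subsection \<open>Symmetries along characteristic lines\<close>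

lemma convex_open_pt_line:
  assumes "convex C" "open C"
  shows "convex {t. z + pt_scale t e \<in> C}" "open {t. z + pt_scale t e \<in> C}"
proof -
  show "convex {t. z + pt_scale t e \<in> C}"
  proof (rule convexI)
    fix s t and a b :: real
    assume st: "s \<in> {t. z + pt_scale t e \<in> C}" "t \<in> {t. z + pt_scale t e \<in> C}"
      and ab: "0 \<le> a" "0 \<le> b" "a + b = 1"
    have "a *\<^sub>R (z + pt_scale s e) + b *\<^sub>R (z + pt_scale t e)
        = (a + b) *\<^sub>R z + pt_scale (a *\<^sub>R s + b *\<^sub>R t) e"
      unfolding scaleR_eq_pt_scale scaleR_conv_of_real
      by (simp add: pt.scale_left_distrib pt.scale_right_distrib)
    then show "a *\<^sub>R s + b *\<^sub>R t \<in> {t. z + pt_scale t e \<in> C}"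
      using convexD[OF assms(1), of "z + pt_scale s e" "z + pt_scale t e" a b] st ab by simp
  qed
  have "continuous_on UNIV (\<lambda>t. z + pt_scale t e)"
    unfolding pt_scale_def
    by (intro continuous_intros linear_continuous_on bounded_linear_scale_left)
  then show "open {t. z + pt_scale t e \<in> C}"
    using open_vimage[OF assms(2), of "\<lambda>t. z + pt_scale t e"] by (simp add: vimage_def)
qed

text \<open>The line through \<open>z\<close> lies in the graph of the solution of slope
  \<open>b\<close> through \<open>z\<close>. A symmetry controls only small pieces of this graph for
  short times, so the local result is applied at each point of the line and then globalised.\<close>

lemma defect_affine:
  fixes A :: "'m::finite \<Rightarrow> complex ^ 'n::finite ^ 'n"
  assumes one: "A one = mat 1" and sym: "infinitesimal_symmetry A one D X"
    and C: "convex C" "open C" "C \<subseteq> D" and z: "z \<in> C"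
  shows "\<exists>d. \<forall>t. z + pt_scale t (v, slope A b v) \<in> C \<longrightarrow>
    defect A b X (z + pt_scale t (v, slope A b v)) = defect A b X z + t *s d"
proof -
  \<comment> \<open>Chosen so that the graph of \<open>u\<close> passes through
    \<open>z\<close>.\<close>
  define c where "c = snd z - slope A b (fst z)"
  define u where "u y = c + slope A b y" for y
  define \<Omega> where "\<Omega> = {y. (y, u y) \<in> C}"
  let ?e = "(v, slope A b v)"
  have line: "z + pt_scale t ?e = (fst z + t *s v, u (fst z + t *s v))" for t
    by (simp add: u_def c_def pt_scale_def prod_eq_iff slope.add_right slope_scale_right)
  have "convex \<Omega>"
  proof (rule convexI)
    fix x y and a a' :: real
    assume xy: "x \<in> \<Omega>" "y \<in> \<Omega>" and a: "0 \<le> a" "0 \<le> a'" "a + a' = 1"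
    have "a *\<^sub>R (x, u x) + a' *\<^sub>R (y, u y)
        = (a *\<^sub>R x + a' *\<^sub>R y, (a + a') *\<^sub>R c + slope A b (a *\<^sub>R x + a' *\<^sub>R y))"
      by (simp add: u_def slope.add_right slope.scaleR_right scaleR_right_distrib scaleR_left_distrib)
    also have "\<dots> = (a *\<^sub>R x + a' *\<^sub>R y, u (a *\<^sub>R x + a' *\<^sub>R y))" using a by (simp add: u_def)
    finally show "a *\<^sub>R x + a' *\<^sub>R y \<in> \<Omega>"
      using convexD[OF C(1), of "(x, u x)" "(y, u y)" a a'] xy a by (simp add: \<Omega>_def)
  qed
  moreover have "open \<Omega>"
  proof -
    have "continuous_on UNIV (\<lambda>y. (y, u y))"
      unfolding u_def by (intro continuous_intros linear_continuous_on slope.bounded_linear_right)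
    then show ?thesis
      using open_vimage[OF C(2), of "\<lambda>y. (y, u y)"] by (simp add: vimage_def \<Omega>_def)
  qed
  ultimately have sol: "solution A one \<Omega> u"
    unfolding u_def by (intro affine_imp_solution one convex_connected)
  have graph: "graph_over u \<Omega> \<subseteq> D" using C(3) by (auto simp: graph_over_def \<Omega>_def)
  let ?S = "{t. z + pt_scale t ?e \<in> C}" and ?g = "\<lambda>t. defect A b X (z + pt_scale t ?e)"
  have "\<exists>d. \<forall>\<alpha>\<in>?S. ?g \<alpha> = ?g 0 + \<alpha> *s d"
  proof (rule locally_affine_imp_affine[OF convex_open_pt_line(2,1)[OF C(1,2)]])
    show "0 \<in> ?S" using z by simp
    fix \<alpha> assume \<alpha>: "\<alpha> \<in> ?S"
    define x where "x = fst z + \<alpha> *s v"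
    have x: "x \<in> \<Omega>" using \<alpha> by (simp add: \<Omega>_def line x_def)
    obtain U W \<epsilon> \<phi> where UW: "open W" "x \<in> W" "graph_over u W \<subseteq> U" "\<epsilon> > 0" "local_flow X D U \<epsilon> \<phi>"
      "\<forall>t\<in>ball 0 \<epsilon>. \<exists>\<Omega>' v. solution A one \<Omega>' v \<and> \<phi> t ` graph_over u W = graph_over v \<Omega>'"
    proof -
      have "\<exists>U W \<epsilon> \<phi>. open U \<and> U \<subseteq> D \<and> open W \<and> x \<in> W \<and> W \<subseteq> \<Omega> \<and> graph_over u W \<subseteq> U \<and>
          \<epsilon> > 0 \<and> local_flow X D U \<epsilon> \<phi> \<and>
          (\<forall>t\<in>ball 0 \<epsilon>. \<exists>\<Omega>' v. solution A one \<Omega>' v \<and> \<phi> t ` graph_over u W = graph_over v \<Omega>')"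
        using conjunct2[OF sym[unfolded infinitesimal_symmetry_def], rule_format, OF _ x, of u] sol graph
        by simp
      then show thesis using that by (elim exE conjE) simp
    qed
    have flow: "\<phi> 0 (y, u y) = (y, u y)"
      "((\<lambda>s. \<phi> s (y, u y)) has_derivative (\<lambda>h. pt_scale h (X (y, u y)))) (at 0)" if "y \<in> W" for y
    proof -
      have "(y, u y) \<in> U" using UW(3) that by (auto simp: graph_over_def)
      from bspec[OF UW(5)[unfolded local_flow_def] this]
      have *: "\<phi> 0 (y, u y) = (y, u y)" "\<forall>t\<in>ball 0 \<epsilon>. \<phi> t (y, u y) \<in> D \<and>
          ((\<lambda>s. \<phi> s (y, u y)) has_derivative (\<lambda>h. pt_scale h (X (\<phi> t (y, u y))))) (at t)"
        by blast+
      show "\<phi> 0 (y, u y) = (y, u y)" by (rule *(1))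
      have "0 \<in> ball (0 :: complex) \<epsilon>" using UW(4) by simp
      from conjunct2[OF bspec[OF *(2) this]]
      show "((\<lambda>s. \<phi> s (y, u y)) has_derivative (\<lambda>h. pt_scale h (X (y, u y)))) (at 0)"
        unfolding *(1) .
    qed
    have "\<exists>r>0. \<exists>d. \<forall>s. norm s < r \<longrightarrow> x + s *s v \<in> W \<and>
        defect A b X (x + s *s v, u (x + s *s v)) = defect A b X (x, u x) + s *s d"
    proof (rule defect_affine_local[OF one UW(1,2) u_def UW(4) flow])
      fix t :: complex assume "t \<in> ball 0 \<epsilon>"
      then obtain \<Omega>' w where w: "solution A one \<Omega>' w" "\<phi> t ` graph_over u W = graph_over w \<Omega>'"
        using UW(6) by blast
      obtain c' b' where cb: "\<forall>y\<in>\<Omega>'. w y = c' + slope A b' y" using solution_imp_affine[of A one, OF one w(1)] by blast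
      have "snd (\<phi> t (y, u y)) = c' + slope A b' (fst (\<phi> t (y, u y)))" if "y \<in> W" for y
      proof -
        have "\<phi> t (y, u y) \<in> graph_over w \<Omega>'" unfolding w(2)[symmetric] using that by (auto simp: graph_over_def)
        then show ?thesis using cb by (auto simp: graph_over_def)
      qed
      then show "\<exists>c b. \<forall>y\<in>W. snd (\<phi> t (y, u y)) = c + slope A b (fst (\<phi> t (y, u y)))" by blast
    qed
    then obtain r d where r: "r > 0" and d: "\<And>s. norm s < r \<Longrightarrow>
        defect A b X (x + s *s v, u (x + s *s v)) = defect A b X (x, u x) + s *s d" by blast
    have "?g (\<alpha> + s) = ?g \<alpha> + s *s d" if "norm s < r" for s
      using d[OF that] unfolding line x_def by (simp add: vec.scale_left_distrib add.assoc)
    then show "\<exists>r>0. \<exists>d. \<forall>s. norm s < r \<longrightarrow> ?g (\<alpha> + s) = ?g \<alpha> + s *s d" using r by blast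
  qed
  then show ?thesis by simp
qed

text \<open>The slope \<open>d\<close> depends on \<open>z\<close> and \<open>b\<close> in an
  uncontrolled way. Expressing it through the value at \<open>h\<close> gives an identity that can
  be differentiated in \<open>z\<close> and \<open>b\<close>.\<close>

lemma defect_interpolation:
  fixes A :: "'m::finite \<Rightarrow> complex ^ 'n::finite ^ 'n"
  assumes "A one = mat 1" "infinitesimal_symmetry A one D X" "convex C" "open C" "C \<subseteq> D" "z \<in> C"
    and "z + pt_scale h (v, slope A b v) \<in> C" "z + pt_scale t (v, slope A b v) \<in> C" "h \<noteq> 0"
  shows "defect A b X (z + pt_scale t (v, slope A b v)) =
    (1 - t / h) *s defect A b X z + (t / h) *s defect A b X (z + pt_scale h (v, slope A b v))"
proof -
  obtain d where d: "\<And>t. z + pt_scale t (v, slope A b v) \<in> C \<Longrightarrow>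
    defect A b X (z + pt_scale t (v, slope A b v)) = defect A b X z + t *s d"
    using defect_affine[OF assms(1-6)] by blast
  show ?thesis
    unfolding d[OF assms(7)] d[OF assms(8)] using \<open>h \<noteq> 0\<close>
    by (simp add: vec.scale_left_diff_distrib vec.scale_right_distrib)
qed

lemma bounded_linear_scale_right: "bounded_linear (\<lambda>v. c *s v)" for c :: complex
  by (rule bounded_linear_intro[where K = "norm c"])
    (simp_all add: norm_vec_scale vec_eq_iff algebra_simps scaleR_conv_of_real[where 'a=complex])

lemma has_vector_derivative_along:
  assumes "(f has_derivative f') (at z)"
  shows "((\<lambda>s. f (z + s *\<^sub>R k)) has_vector_derivative f' k) (at 0)"
proof -
  have "((\<lambda>s. z + s *\<^sub>R k) has_derivative (\<lambda>s. s *\<^sub>R k)) (at 0)"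
    by (auto intro!: derivative_eq_intros)
  from has_derivative_compose[OF this, of f f'] assms
  have "((\<lambda>s. f (z + s *\<^sub>R k)) has_derivative (\<lambda>s. f' (s *\<^sub>R k))) (at 0)" by simp
  then show ?thesis
    using bounded_linear.linear[OF has_derivative_bounded_linear[OF assms]]
    by (simp add: has_vector_derivative_def linear_cmul)
qed

text \<open>Base point and slope vary together along a real parameter; the last term comes from the
  change of the slope.\<close>

lemma defect_has_vector_derivative:
  assumes "(X has_derivative X') (at z)"
  shows "((\<lambda>s. defect A (b + s *\<^sub>R b') X (z + s *\<^sub>R k)) has_vector_derivative
    (snd (X' k) - slope A b (fst (X' k)) - slope A b' (fst (X z)))) (at 0)"
proof -
  let ?Z = "\<lambda>s. X (z + s *\<^sub>R k)"
  have Z: "(?Z has_vector_derivative X' k) (at 0)" by (rule has_vector_derivative_along[OF assms])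
  note fst' = bounded_linear.has_vector_derivative[OF bounded_linear_fst Z]
  note snd' = bounded_linear.has_vector_derivative[OF bounded_linear_snd Z]
  have 1: "((\<lambda>s. slope A b (fst (?Z s))) has_vector_derivative slope A b (fst (X' k))) (at 0)"
    by (rule bounded_linear.has_vector_derivative[OF slope.bounded_linear_right fst'])
  have 2: "((\<lambda>s. slope A b' (fst (?Z s))) has_vector_derivative slope A b' (fst (X' k))) (at 0)"
    by (rule bounded_linear.has_vector_derivative[OF slope.bounded_linear_right fst'])
  have "((\<lambda>s. s *\<^sub>R slope A b' (fst (?Z s))) has_vector_derivative
      (0 *\<^sub>R slope A b' (fst (X' k)) + 1 *\<^sub>R slope A b' (fst (?Z 0)))) (at 0)"
    by (rule has_vector_derivative_scaleR[OF DERIV_ident 2])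
  from has_vector_derivative_diff[OF has_vector_derivative_diff[OF snd' 1] this]
  show ?thesis
    by (simp add: defect_def slope.add_left slope.scaleR_left diff_diff_eq)
qed

lemma vector_derivative_eq_of_eventually_eq:
  assumes "\<forall>\<^sub>F s in nhds x. f s = g s"
    and "(f has_vector_derivative a) (at x)" "(g has_vector_derivative b) (at x)"
  shows "a = b"
proof -
  have "\<forall>\<^sub>F s in nhds x. s \<in> UNIV \<longrightarrow> f s = g s" using assms(1) by simp
  then have "(g has_vector_derivative a) (at x)"
    using has_vector_derivative_cong_ev[of UNIV f g x a] eventually_nhds_x_imp_x[OF assms(1)] assms(2) by simp
  then show ?thesis using assms(3) by (rule vector_derivative_unique_at)
qed

lemma eventually_along_in_open:
  fixes z k :: "'a::real_normed_vector"
  assumes "open C" "z \<in> C"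
  shows "\<forall>\<^sub>F s in nhds (0::real). z + s *\<^sub>R k \<in> C"
proof -
  have "((\<lambda>s. z + s *\<^sub>R k) \<longlongrightarrow> z + 0 *\<^sub>R k) (nhds 0)"
    by (intro tendsto_intros filterlim_ident)
  then show ?thesis using topological_tendstoD[of _ z "nhds 0" C] assms by simp
qed

lemma symmetry_quadratic_along:
  fixes A :: "'m::finite \<Rightarrow> complex ^ 'n::finite ^ 'n"
  assumes one: "A one = mat 1" and sym: "infinitesimal_symmetry A one D X"
    and C: "convex C" "open C" "C \<subseteq> D"
  shows "quadratic_along (v, slope A b v) X C"
  unfolding quadratic_along_def
proof
  fix z assume z: "z \<in> C"
  let ?e = "(v, slope A b v)"
  note interpolation = defect_interpolation[OF one sym C]
  have "\<forall>x\<in>C. \<exists>X'. (X has_derivative X') (at x) \<and> Vector_Spaces.linear pt_scale pt_scale X'"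
    using conjunct1[OF sym[unfolded infinitesimal_symmetry_def]] C(3)
    unfolding holomorphic_map_on_def by blast
  from bchoice[OF this] obtain X' where
    "\<forall>x\<in>C. (X has_derivative X' x) (at x) \<and> Vector_Spaces.linear pt_scale pt_scale (X' x)" ..
  then have X': "\<And>x. x \<in> C \<Longrightarrow> (X has_derivative X' x) (at x)"
    "\<And>x. x \<in> C \<Longrightarrow> Vector_Spaces.linear pt_scale pt_scale (X' x)" by simp_all
  obtain h :: complex where h: "h \<noteq> 0" "z + pt_scale h ?e \<in> C"
  proof -
    have "0 \<in> {t. z + pt_scale t ?e \<in> C}" using z by simp
    then obtain r where r: "r > 0" "ball 0 r \<subseteq> {t. z + pt_scale t ?e \<in> C}"
      by (rule openE[OF convex_open_pt_line(2)[OF C(1,2)]])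
    then have "complex_of_real (r / 2) \<in> ball 0 r" "complex_of_real (r / 2) \<noteq> 0" by auto
    then show thesis using that r(2) by blast
  qed
  have "\<exists>a0 a1 a2. \<forall>t. z + pt_scale t ?e \<in> C \<longrightarrow>
      fst (X (z + pt_scale t ?e)) $ i = a0 + t * a1 + t\<^sup>2 * a2" for i
  proof -
    \<comment> \<open>The rate of change of the direction when \<open>b\<close> moves along
      \<open>axis i 1\<close>, see \<open>e_s\<close>.\<close>
    define d where "d = (0 :: complex ^ 'n, slope A (axis i 1) v)"
    define G where "G x = snd (X' x d) - slope A b (fst (X' x d))" for x
    define H where "H x = slope A (axis i 1) (fst (X x))" for x
    have e_s: "(v, slope A (b + s *\<^sub>R axis i 1) v) = ?e + s *\<^sub>R d" for s
      by (simp add: d_def slope.add_left slope.scaleR_left)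
    \<comment> \<open>First derivative: \<open>b\<close> is kept, and the three points of the
      interpolation identity are all shifted by s d.\<close>
    have G: "G (z + pt_scale t ?e) = (1 - t / h) *s G z + (t / h) *s G (z + pt_scale h ?e)"
      if t: "z + pt_scale t ?e \<in> C" for t
    proof -
      have eq: "\<forall>\<^sub>F s in nhds 0. defect A (b + s *\<^sub>R 0) X (z + pt_scale t ?e + s *\<^sub>R d) =
          (1 - t / h) *s defect A (b + s *\<^sub>R 0) X (z + s *\<^sub>R d)
          + (t / h) *s defect A (b + s *\<^sub>R 0) X (z + pt_scale h ?e + s *\<^sub>R d)"
        using eventually_along_in_open[OF C(2) z, of d] eventually_along_in_open[OF C(2) h(2), of d]
          eventually_along_in_open[OF C(2) t, of d]
      proof eventually_elim
        case (elim s)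
        then show ?case
          using interpolation[of "z + s *\<^sub>R d" h v b t] h(1) by (simp add: add_ac)
      qed
      have L: "((\<lambda>s. defect A (b + s *\<^sub>R 0) X (z + pt_scale t ?e + s *\<^sub>R d)) has_vector_derivative
          G (z + pt_scale t ?e)) (at 0)"
        using defect_has_vector_derivative[OF X'(1)[OF t], of A b 0 d] by (simp add: G_def slope.zero_left)
      have "((\<lambda>s. (1 - t / h) *s defect A (b + s *\<^sub>R 0) X (z + s *\<^sub>R d)
          + (t / h) *s defect A (b + s *\<^sub>R 0) X (z + pt_scale h ?e + s *\<^sub>R d)) has_vector_derivative
          ((1 - t / h) *s G z + (t / h) *s G (z + pt_scale h ?e))) (at 0)"
        using defect_has_vector_derivative[OF X'(1)[OF z], of A b 0 d]
          defect_has_vector_derivative[OF X'(1)[OF h(2)], of A b 0 d]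
        by (intro has_vector_derivative_add bounded_linear.has_vector_derivative[OF bounded_linear_scale_right])
          (simp_all add: G_def slope.zero_left)
      then show ?thesis by (rule vector_derivative_eq_of_eventually_eq[OF eq L])
    qed
    \<comment> \<open>Second derivative: \<open>z\<close> is kept and \<open>b\<close> varies. The
      direction changes by s d, so the point with parameter t moves by s t d, which accounts for the
      factor t in front of \<open>G\<close>.\<close>
    have H: "t *s G (z + pt_scale t ?e) - H (z + pt_scale t ?e) = (1 - t / h) *s (- H z)
        + (t / h) *s (h *s G (z + pt_scale h ?e) - H (z + pt_scale h ?e))"
      if t: "z + pt_scale t ?e \<in> C" for t
    proof -
      have eq: "\<forall>\<^sub>F s in nhds 0.
          defect A (b + s *\<^sub>R axis i 1) X (z + pt_scale t ?e + s *\<^sub>R pt_scale t d) =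
          (1 - t / h) *s defect A (b + s *\<^sub>R axis i 1) X (z + s *\<^sub>R 0)
          + (t / h) *s defect A (b + s *\<^sub>R axis i 1) X (z + pt_scale h ?e + s *\<^sub>R pt_scale h d)"
        using eventually_along_in_open[OF C(2) h(2), of "pt_scale h d"]
          eventually_along_in_open[OF C(2) t, of "pt_scale t d"]
      proof eventually_elim
        case (elim s)
        have "pt_scale \<tau> (v, slope A (b + s *\<^sub>R axis i 1) v) = pt_scale \<tau> ?e + s *\<^sub>R pt_scale \<tau> d" for \<tau>
          unfolding e_s scaleR_eq_pt_scale by (simp add: pt.scale_right_distrib mult.commute)
        then show ?case
          using elim interpolation[of z h v "b + s *\<^sub>R axis i 1" t] h(1) z by (simp add: add.assoc)
      qed
      have der: "((\<lambda>s. defect A (b + s *\<^sub>R axis i 1) X (z + pt_scale \<tau> ?e + s *\<^sub>R pt_scale \<tau> d))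
          has_vector_derivative \<tau> *s G (z + pt_scale \<tau> ?e) - H (z + pt_scale \<tau> ?e)) (at 0)"
        if \<tau>: "z + pt_scale \<tau> ?e \<in> C" for \<tau>
      proof -
        \<comment> \<open>Holomorphy of X enters here: \<tau> is complex, so real linearity of the
          derivative would not extract it.\<close>
        have "X' (z + pt_scale \<tau> ?e) (pt_scale \<tau> d) = pt_scale \<tau> (X' (z + pt_scale \<tau> ?e) d)"
          using X'(2)[OF \<tau>] unfolding Vector_Spaces.linear_iff by blast
        then show ?thesis
          using defect_has_vector_derivative[OF X'(1)[OF \<tau>], of A b "axis i 1" "pt_scale \<tau> d"]
          by (simp add: G_def H_def pt_scale_def slope_scale_right vector_ssub_ldistrib)
      qed
      have "((\<lambda>s. defect A (b + s *\<^sub>R axis i 1) X (z + s *\<^sub>R 0)) has_vector_derivative - H z) (at 0)"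
        using der[of 0] z by simp
      then have "((\<lambda>s. (1 - t / h) *s defect A (b + s *\<^sub>R axis i 1) X (z + s *\<^sub>R 0)
          + (t / h) *s defect A (b + s *\<^sub>R axis i 1) X (z + pt_scale h ?e + s *\<^sub>R pt_scale h d))
          has_vector_derivative ((1 - t / h) *s (- H z)
            + (t / h) *s (h *s G (z + pt_scale h ?e) - H (z + pt_scale h ?e)))) (at 0)"
        by (intro has_vector_derivative_add bounded_linear.has_vector_derivative[OF bounded_linear_scale_right] der h)
      then show ?thesis by (rule vector_derivative_eq_of_eventually_eq[OF eq der[OF t]])
    qed
    \<comment> \<open>In component \<open>one\<close> the slope is the plain pairing, so the unit
      vector selects coordinate i.\<close>
    have Hi: "H x $ one = fst (X x) $ i" for x
      by (simp add: H_def slope_one[of A one, OF one] axis_def if_distrib if_distribR cong: if_cong)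
    define g0 where "g0 = G z $ one"
    define g1 where "g1 = G (z + pt_scale h ?e) $ one"
    define x0 where "x0 = fst (X z) $ i"
    define x1 where "x1 = fst (X (z + pt_scale h ?e)) $ i"
    have "fst (X (z + pt_scale t ?e)) $ i = x0 + t * (g0 - x0 / h - g1 + x1 / h) + t\<^sup>2 * ((g1 - g0) / h)"
      if t: "z + pt_scale t ?e \<in> C" for t
    proof -
      have G_one: "G (z + pt_scale t ?e) $ one = (1 - t / h) * g0 + (t / h) * g1"
        unfolding g0_def g1_def G[OF t] by (simp add: algebra_simps)
      have H_one: "t * G (z + pt_scale t ?e) $ one - fst (X (z + pt_scale t ?e)) $ i
          = (1 - t / h) * (- x0) + (t / h) * (h * g1 - x1)"
        using arg_cong[OF H[OF t], of "\<lambda>w. w $ one"] by (simp add: g1_def x0_def x1_def Hi algebra_simps)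
      have "y = g - s" if "g - y = s" for y g s :: complex using that by auto
      from this[OF H_one] have "fst (X (z + pt_scale t ?e)) $ i =
          t * ((1 - t / h) * g0 + (t / h) * g1) - ((1 - t / h) * (- x0) + (t / h) * (h * g1 - x1))"
        unfolding G_one .
      also have "\<dots> = x0 + t * (g0 - x0 / h - g1 + x1 / h) + t\<^sup>2 * ((g1 - g0) / h)"
        using h(1) by (simp add: field_simps power2_eq_square)
      finally show ?thesis .
    qed
    then show ?thesis by blast
  qed
  then have "\<forall>i. \<exists>a0 a1 a2. \<forall>t. z + pt_scale t ?e \<in> C \<longrightarrow>
      fst (X (z + pt_scale t ?e)) $ i = a0 + t * a1 + t\<^sup>2 * a2" ..
  from choice[OF this] obtain a0 where "\<forall>i. \<exists>a1 a2. \<forall>t. z + pt_scale t ?e \<in> C \<longrightarrow>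
      fst (X (z + pt_scale t ?e)) $ i = a0 i + t * a1 + t\<^sup>2 * a2" ..
  from choice[OF this] obtain a1 where "\<forall>i. \<exists>a2. \<forall>t. z + pt_scale t ?e \<in> C \<longrightarrow>
      fst (X (z + pt_scale t ?e)) $ i = a0 i + t * a1 i + t\<^sup>2 * a2" ..
  from choice[OF this] obtain a2 where a: "\<forall>i t. z + pt_scale t ?e \<in> C \<longrightarrow>
      fst (X (z + pt_scale t ?e)) $ i = a0 i + t * a1 i + t\<^sup>2 * a2 i" ..
  define x0 where "x0 = (\<chi> i. a0 i)"
  define x1 where "x1 = (\<chi> i. a1 i)"
  define x2 where "x2 = (\<chi> i. a2 i)"
  have fst_X: "fst (X (z + pt_scale t ?e)) = x0 + t *s x1 + t\<^sup>2 *s x2" if "z + pt_scale t ?e \<in> C" for t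
    using a that by (simp add: vec_eq_iff x0_def x1_def x2_def)
  \<comment> \<open>The u-part of X is the defect, which is affine, plus \<open>slope A b\<close> of
    the x-part, now known to be quadratic.\<close>
  obtain f where f: "\<And>t. z + pt_scale t ?e \<in> C \<Longrightarrow>
      defect A b X (z + pt_scale t ?e) = defect A b X z + t *s f"
    using defect_affine[OF one sym C z] by blast
  have "X (z + pt_scale t ?e) = (x0, defect A b X z + slope A b x0) + pt_scale t (x1, f + slope A b x1)
      + pt_scale (t\<^sup>2) (x2, slope A b x2)" if t: "z + pt_scale t ?e \<in> C" for t
  proof -
    have "snd (X (z + pt_scale t ?e)) = defect A b X (z + pt_scale t ?e) + slope A b (fst (X (z + pt_scale t ?e)))"
      by (simp add: defect_def)
    then have "snd (X (z + pt_scale t ?e)) =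
        defect A b X z + t *s f + slope A b (x0 + t *s x1 + t\<^sup>2 *s x2)"
      by (simp only: fst_X[OF t] f[OF t])
    then show ?thesis
      using fst_X[OF t]
      by (simp add: prod_eq_iff pt_scale_def slope.add_right slope_scale_right vec.scale_right_distrib add_ac)
  qed
  then show "\<exists>a b c. \<forall>t. z + pt_scale t ?e \<in> C \<longrightarrow>
      X (z + pt_scale t ?e) = a + pt_scale t b + pt_scale (t\<^sup>2) c" by blast
qed

text \<open>The choice b = 0 gives the horizontal vectors (axis i 1, 0). Subtracting them from the
  directions with b = axis j 1 leaves vertical vectors whose entries are the (i, j) entries of all
  \<open>A k\<close>. These span because row rank equals column rank.\<close>

lemma span_characteristic_directions:
  fixes A :: "'m::finite \<Rightarrow> complex ^ 'n::finite ^ 'n"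
  assumes "inj A" "\<not> cmat.dependent (range A)"
  defines "E \<equiv> (\<lambda>(i, b). (axis i 1, slope A b (axis i 1))) ` (UNIV \<times> insert 0 (range (\<lambda>j. axis j 1)))"
  shows "pt.span E = UNIV"
proof -
  have E_mem: "(axis i 1, slope A b (axis i 1)) \<in> E" if "b \<in> insert 0 (range (\<lambda>j. axis j 1))" for i b
    unfolding E_def using that by (intro image_eqI[of _ _ "(i, b)"]) auto
  have slope_aa: "slope A (axis j 1) (axis i 1) $ k = A k $ i $ j" for i j k
    unfolding slope_axis by (simp add: matrix_vector_mult_def axis_def if_distrib cong: if_cong)
  \<comment> \<open>Row k lists the entries of \<open>A k\<close>, so independence of the matrices
    is independence of the rows.\<close>
  define M :: "complex ^ ('n \<times> 'n) ^ 'm" where "M = (\<chi> k p. A k $ fst p $ snd p)"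
  have "c k = 0" if c: "(\<Sum>k\<in>UNIV. c k *s row k M) = 0" for c k
  proof -
    have "(\<Sum>k\<in>UNIV. c k * A k $ i $ j) = 0" for i j
      using arg_cong[OF c, of "\<lambda>r. r $ (i, j)"] by (simp add: row_def M_def)
    then have sum0: "(\<Sum>k\<in>UNIV. mat_scale (c k) (A k)) = 0"
      by (simp add: vec_eq_iff mat_scale_def)
    \<comment> \<open>Independence is stated for the set \<open>range A\<close>; injectivity
      translates a relation indexed by k into one indexed by matrices.\<close>
    have "(\<Sum>B\<in>range A. mat_scale (c (inv A B)) B) = 0"
      using sum0 by (simp add: sum.reindex[OF assms(1)] inv_f_f[OF assms(1)])
    then have "\<forall>B\<in>range A. c (inv A B) = 0"
      using assms(2) unfolding cmat.dependent_finite[OF finite_imageI[OF finite]]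
      by auto
    then show ?thesis by (simp add: inv_f_f[OF assms(1)])
  qed
  then have "vec.span (columns M) = UNIV"
    using matrix_right_invertible_independent_rows[of M] matrix_right_invertible_span_columns[of M] by blast
  moreover have "vec.span (columns M) \<subseteq> {y. (0, y) \<in> pt.span E}"
  proof (rule vec.span_minimal)
    show "columns M \<subseteq> {y. (0, y) \<in> pt.span E}"
    proof
      fix y assume "y \<in> columns M"
      then obtain i j where y: "y = column (i, j) M" by (auto simp: columns_def)
      have "y = slope A (axis j 1) (axis i 1)"
        by (simp add: y column_def M_def slope_aa vec_eq_iff)
      moreover have "(axis i 1, slope A (axis j 1) (axis i 1)) - (axis i 1, slope A 0 (axis i 1)) \<in> pt.span E"
        by (intro pt.span_diff pt.span_base E_mem) auto
      ultimately show "y \<in> {y. (0, y) \<in> pt.span E}" by (simp add: slope.zero_left)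
    qed
    show "vec.subspace {y. (0, y) \<in> pt.span E}"
    proof (rule vec.subspaceI)
      show "0 \<in> {y. (0, y) \<in> pt.span E}" using pt.span_zero by (simp add: zero_prod_def)
    next
      fix x y assume "x \<in> {y. (0, y) \<in> pt.span E}" "y \<in> {y. (0, y) \<in> pt.span E}"
      then have "(0, x) + (0, y) \<in> pt.span E" by (intro pt.span_add) auto
      then show "x + y \<in> {y. (0, y) \<in> pt.span E}" by simp
    next
      fix c x assume "x \<in> {y. (0, y) \<in> pt.span E}"
      then have "pt_scale c (0, x) \<in> pt.span E" by (intro pt.span_scale) auto
      then show "c *s x \<in> {y. (0, y) \<in> pt.span E}" by (simp add: pt_scale_def)
    qed
  qed
  ultimately have snd_in: "(0, y) \<in> pt.span E" for y by auto
  have fst_in: "(x, 0) \<in> pt.span E" for x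
  proof -
    have "(\<Sum>i\<in>UNIV. pt_scale (x $ i) (axis i 1, slope A 0 (axis i 1))) \<in> pt.span E"
      by (intro pt.span_sum pt.span_scale pt.span_base E_mem) auto
    also have "(\<Sum>i\<in>UNIV. pt_scale (x $ i) (axis i 1, slope A 0 (axis i 1))) = (x, 0)"
      by (simp add: pt_scale_def slope.zero_left prod_eq_iff fst_sum snd_sum basis_expansion)
    finally show ?thesis .
  qed
  have "(x, y) \<in> pt.span E" for x y
    using pt.span_add[OF fst_in[of x] snd_in[of y]] by simp
  then show ?thesis by auto
qed

text \<open>One finite \<open>M\<close> serves all domains at once, because the monomials are
  defined on the whole space. The basis is selected from characteristic directions, along which
  every symmetry is quadratic.\<close>

lemma symmetries_in_finite_span:
  fixes A :: "'m::finite \<Rightarrow> complex ^ 'n::finite ^ 'n"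
  assumes one: "A one = mat 1" and "inj A" and "\<not> cmat.dependent (range A)"
  obtains M :: "('n, 'm) vfield set" where "finite M"
    "\<And>D X. open D \<Longrightarrow> connected D \<Longrightarrow> infinitesimal_symmetry A one D X \<Longrightarrow>
      \<exists>Y\<in>vf.span M. \<forall>z\<in>D. X z = Y z"
proof -
  define E where "E = (\<lambda>(i, b). (axis i (1 :: complex), slope A b (axis i 1))) `
    (UNIV \<times> insert 0 (range (\<lambda>j. axis j 1)))"
  have E: "pt.span E = UNIV"
    unfolding E_def by (rule span_characteristic_directions[OF assms(2,3)])
  have "finite E" unfolding E_def by (intro finite_imageI finite_cartesian_product) auto
  obtain B where B: "B \<subseteq> E" "pt.independent B" "E \<subseteq> pt.span B"
    using pt.maximal_independent_subset by blast
  interpret pt_basis B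
  proof
    show "finite B" using B(1) \<open>finite E\<close> by (rule finite_subset)
    show "pt.independent B" by (rule B(2))
    have "pt.span E \<subseteq> pt.span B" using B(3) by (intro pt.span_minimal pt.subspace_span)
    then show "pt.span B = UNIV" using E by blast
  qed
  obtain es where es: "distinct es" "set es = B"
    using finite_distinct_list[OF finite_basis] by blast
  show thesis
  proof (rule that[OF finite_monomials[of es]])
    fix D X assume D: "open D" "connected D" and X: "infinitesimal_symmetry A one D X"
    show "\<exists>Y\<in>vf.span (monomials es). \<forall>z\<in>D. X z = Y z"
    proof (rule locally_quadratic_in_span[OF es D(2)])
      fix q assume "q \<in> D"
      then obtain r where r: "r > 0" "polydisc q r \<subseteq> D" by (rule polydisc_in_open[OF D(1)])
      have "quadratic_along e X (polydisc q r)" if "e \<in> B" for e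
      proof -
        have "e \<in> E" using that B(1) by blast
        then obtain v b where "e = (v, slope A b v)" by (auto simp: E_def)
        then show ?thesis
          using symmetry_quadratic_along[OF one X convex_polydisc open_polydisc r(2)] by simp
      qed
      then show "\<exists>r>0. polydisc q r \<subseteq> D \<and> (\<forall>e\<in>B. quadratic_along e X (polydisc q r))"
        using r by blast
    qed
  qed
qed

theorem theorem6p1:
  fixes A :: "'m::finite \<Rightarrow> complex ^ 'n::finite ^ 'n" and one :: 'm
  assumes "A one = mat 1"
    and "inj A" and "\<not> cmat.dependent (range A)"
  shows "(\<forall>D. open D \<and> connected D \<and> D \<noteq> {} \<longrightarrow> fin_dim (Lie_on A one D))
    \<and> (\<forall>p. germs_fin_dim p (Lie_at A one p))"
proof (intro conjI allI impI)
  obtain M :: "('n, 'm) vfield set" where M: "finite M"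
    "\<And>D X. open D \<Longrightarrow> connected D \<Longrightarrow> infinitesimal_symmetry A one D X \<Longrightarrow>
      \<exists>Y\<in>vf.span M. \<forall>z\<in>D. X z = Y z"
  proof (rule symmetries_in_finite_span[of A one, OF assms])
    fix M :: "('n, 'm) vfield set"
    assume "finite M" and "\<And>D X. open D \<Longrightarrow> connected D \<Longrightarrow> infinitesimal_symmetry A one D X \<Longrightarrow>
      \<exists>Y\<in>vf.span M. \<forall>z\<in>D. X z = Y z"
    then show thesis by (rule that)
  qed
  show "fin_dim (Lie_on A one D)" if D: "open D \<and> connected D \<and> D \<noteq> {}" for D
  proof -
    \<comment> \<open>Equality with respect to \<open>principal D\<close> is equality on
      \<open>D\<close>.\<close>
    have "\<exists>B. finite B \<and> B \<subseteq> Lie_on A one D \<and>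
        (\<forall>X\<in>Lie_on A one D. \<exists>Y\<in>vf.span B. \<forall>\<^sub>F z in principal D. X z = Y z)"
    proof (rule finite_dimensional_modulo_filter[OF M(1)])
      fix X assume "X \<in> Lie_on A one D"
      then have "infinitesimal_symmetry A one D X" by (simp add: Lie_on_def)
      then show "\<exists>Y\<in>vf.span M. \<forall>\<^sub>F z in principal D. X z = Y z"
        unfolding eventually_principal using D by (intro M(2)) simp_all
    qed
    then obtain B where B: "finite B" "B \<subseteq> Lie_on A one D"
      "\<forall>X\<in>Lie_on A one D. \<exists>Y\<in>vf.span B. \<forall>\<^sub>F z in principal D. X z = Y z"
      by (elim exE conjE)
    \<comment> \<open>Off \<open>D\<close> all elements of \<open>Lie_on A one D\<close>, and hence
      of the span of \<open>B\<close>, are 0, which turns equality on \<open>D\<close> into equality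
      of functions.\<close>
    have "vf.subspace {X. \<forall>z. z \<notin> D \<longrightarrow> X z = 0}"
      by (rule vf.subspaceI) (simp_all add: vf_scale_def)
    moreover have "B \<subseteq> {X. \<forall>z. z \<notin> D \<longrightarrow> X z = 0}"
      using B(2) unfolding Lie_on_def by blast
    ultimately have span: "vf.span B \<subseteq> {X. \<forall>z. z \<notin> D \<longrightarrow> X z = 0}"
      by (intro vf.span_minimal)
    have "X \<in> vf.span B" if X: "X \<in> Lie_on A one D" for X
    proof -
      obtain Y where Y: "Y \<in> vf.span B" "\<forall>z\<in>D. X z = Y z"
        using bspec[OF B(3) X] unfolding eventually_principal by blast
      have "X z = Y z" for z
      proof (cases "z \<in> D")
        case False
        then have "X z = 0" "Y z = 0" using X subsetD[OF span Y(1)] unfolding Lie_on_def by blast+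
        then show ?thesis by simp
      qed (use Y in blast)
      then have "X = Y" by (rule ext)
      then show ?thesis using Y by simp
    qed
    then show ?thesis unfolding fin_dim_def using B by blast
  qed
  show "germs_fin_dim p (Lie_at A one p)" for p
    unfolding germs_fin_dim_def
  proof (rule finite_dimensional_modulo_filter[OF M(1)])
    fix X assume "X \<in> Lie_at A one p"
    \<comment> \<open>The domain may shrink with \<open>X\<close>; this is harmless because
      \<open>M\<close> does not depend on it.\<close>
    then obtain D where D: "open D" "connected D" "p \<in> D" "infinitesimal_symmetry A one D X"
      unfolding Lie_at_def Lie_on_def by blast
    obtain Y where Y: "Y \<in> vf.span M" "\<forall>z\<in>D. X z = Y z" using M(2)[OF D(1,2,4)] by blast
    have "\<forall>\<^sub>F z in nhds p. X z = Y z"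
      using eventually_nhds_in_open[OF D(1,3)] by (rule eventually_mono) (use Y(2) in blast)
    then show "\<exists>Y\<in>vf.span M. \<forall>\<^sub>F z in nhds p. X z = Y z" using Y(1) by blast
  qed
qed

end
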